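(* Let $\mathcal R$ be a top tree of height $h$ over $(T,\partial T)$, and let $\mathrm{select}$ be any function that, given a root cluster with two children, returns one of them. If $|\partial T|\le 1$, then after $O(h)$ calls to $\mathrm{select}$, $\mathrm{join}$ and $\mathrm{split}$ there is a unique edge $(v,w)$ contained in every cluster chosen by $\mathrm{select}$, and this edge is returned; afterwards the top tree is restored to its original state with $O(h)$ calls to $\mathrm{join}$ and $\mathrm{split}$. Here the search proceeds down $\mathcal R$: while the current cluster $C$ of $\mathcal R$ (initially the root) is not a single edge, with children $A,B$ in $\mathcal R$, $\mathrm{select}$ is called on a root cluster $\mathrm{join}(A^*,B^* )$ with $A\subseteq A^*$, $B\subseteq B^*$, $A^*\cup B^*=T$, and the new current cluster is $A$ or $B$ according to whether $A^*$ or $B^*$ is selected. If $\partial T=\{x,y\}$ with $x\ne y$, the same process (calling $\mathrm{select}$ only when both children of the current cluster are path children, otherwise descending to the unique path child) ends with a unique edge $(v,w)$ on the path from $x$ to $y$, within the same bounds.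
   Context: Given a tree $T$ and a set $\partial T$ of at most two external boundary vertices, the boundary $\partial C$ of a subtree $C$ is the set of its vertices that are in $\partial T$ or incident to an edge of $T$ not in $C$. A cluster is a subtree with at least one edge and $|\partial C|\le2$. A top tree is a binary tree of clusters whose leaves are the single edges of $T$, whose sibling clusters are edge-disjoint, meet in one vertex and have their union as parent, and whose root is $T$. $\mathrm{join}(A,B)$ creates a new root $A\cup B$ over two neighboring root clusters; $\mathrm{split}(C)$ removes a root $C$ leaving its children as roots. If $|\partial C|=2$, its cluster path is the path between its two boundary vertices; a child $A$ of $C$ is a path child if it shares an edge with the cluster path of $C$. *)

theory Defs
  imports Main
begin

section \<open>Trees, subtrees, boundaries, clusters\<close>

text \<open>A graph is given by its edge set; an edge is a 2-element vertex set.
  The vertex set of the tree is the union of its edges.\<close>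

definition conn_on :: "'v set \<Rightarrow> 'v set set \<Rightarrow> bool" where
  "conn_on V F \<longleftrightarrow> (\<forall>u\<in>V. \<forall>v\<in>V. (u, v) \<in> {(a, b). {a, b} \<in> F}\<^sup>*)"

text \<open>A tree: a finite, connected graph that becomes disconnected when any edge
  is removed (minimally connected).\<close>
definition is_tree :: "'v set set \<Rightarrow> bool" where
  "is_tree E \<longleftrightarrow> finite E \<and> (\<forall>e\<in>E. card e = 2) \<and> conn_on (\<Union>E) E
     \<and> (\<forall>e\<in>E. \<not> conn_on (\<Union>E) (E - {e}))"

definition is_subtree :: "'v set set \<Rightarrow> 'v set set \<Rightarrow> bool" where
  "is_subtree E C \<longleftrightarrow> C \<subseteq> E \<and> C \<noteq> {} \<and> conn_on (\<Union>C) C"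

text \<open>Boundary of a subtree C of T=E with external boundary B.\<close>
definition bd :: "'v set set \<Rightarrow> 'v set \<Rightarrow> 'v set set \<Rightarrow> 'v set" where
  "bd E B C = {v \<in> \<Union>C. v \<in> B \<or> (\<exists>e\<in>E - C. v \<in> e)}"

definition is_cluster :: "'v set set \<Rightarrow> 'v set \<Rightarrow> 'v set set \<Rightarrow> bool" where
  "is_cluster E B C \<longleftrightarrow> is_subtree E C \<and> card (bd E B C) \<le> 2"

section \<open>Paths, cluster paths, path children\<close>

definition is_path :: "'v set set \<Rightarrow> 'v list \<Rightarrow> bool" where
  "is_path F P \<longleftrightarrow> P \<noteq> [] \<and> distinct P \<and> (\<forall>i. Suc i < length P \<longrightarrow> {P ! i, P ! Suc i} \<in> F)"

text \<open>Edges of the (in a tree unique) path from u to v in F.\<close>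
definition path_edges :: "'v set set \<Rightarrow> 'v \<Rightarrow> 'v \<Rightarrow> 'v set set" where
  "path_edges F u v = {e. \<exists>P. is_path F P \<and> hd P = u \<and> last P = v
       \<and> (\<exists>i. Suc i < length P \<and> e = {P ! i, P ! Suc i})}"

definition cluster_path :: "'v set set \<Rightarrow> 'v set \<Rightarrow> 'v set set \<Rightarrow> 'v set set" where
  "cluster_path E B C = {e. \<exists>u v. u \<noteq> v \<and> bd E B C = {u, v} \<and> e \<in> path_edges C u v}"

text \<open>A is a path child of C (C with two boundary vertices) if it shares an
  edge with the cluster path of C.\<close>
definition path_child :: "'v set set \<Rightarrow> 'v set \<Rightarrow> 'v set set \<Rightarrow> 'v set set \<Rightarrow> bool" where
  "path_child E B C A \<longleftrightarrow> card (bd E B C) = 2 \<and> A \<inter> cluster_path E B C \<noteq> {}"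

section \<open>Top trees\<close>

datatype 'v tt = Leaf "'v set" | Node "'v tt" "'v tt"

fun edges :: "'v tt \<Rightarrow> 'v set set" where
  "edges (Leaf e) = {e}"
| "edges (Node l r) = edges l \<union> edges r"

fun height :: "'v tt \<Rightarrow> nat" where
  "height (Leaf e) = 0"
| "height (Node l r) = Suc (max (height l) (height r))"

fun valid_tt :: "'v set set \<Rightarrow> 'v set \<Rightarrow> 'v tt \<Rightarrow> bool" where
  "valid_tt E B (Leaf e) \<longleftrightarrow> e \<in> E"
| "valid_tt E B (Node l r) \<longleftrightarrow> valid_tt E B l \<and> valid_tt E B r
     \<and> edges l \<inter> edges r = {}
     \<and> card (\<Union>(edges l) \<inter> \<Union>(edges r)) = 1
     \<and> is_cluster E B (edges l \<union> edges r)"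

definition top_tree :: "'v set set \<Rightarrow> 'v set \<Rightarrow> 'v tt \<Rightarrow> bool" where
  "top_tree E B R \<longleftrightarrow> valid_tt E B R \<and> edges R = E"

section \<open>Operations on the top forest (set of root clusters)\<close>

datatype 'v op = Join "'v tt" "'v tt" | Split "'v tt" | Select "'v tt" | Return "'v set" | Stop

fun valid_op :: "'v set set \<Rightarrow> 'v set \<Rightarrow> 'v tt set \<Rightarrow> 'v op \<Rightarrow> bool" where
  "valid_op E B S (Join a b) \<longleftrightarrow> a \<in> S \<and> b \<in> S \<and> a \<noteq> b
     \<and> edges a \<inter> edges b = {}
     \<and> card (\<Union>(edges a) \<inter> \<Union>(edges b)) = 1
     \<and> is_cluster E B (edges a \<union> edges b)"
| "valid_op E B S (Split c) \<longleftrightarrow> c \<in> S \<and> (\<exists>l r. c = Node l r)"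
| "valid_op E B S (Select c) \<longleftrightarrow> c \<in> S \<and> (\<exists>l r. c = Node l r)"
| "valid_op E B S (Return e) \<longleftrightarrow> True"
| "valid_op E B S Stop \<longleftrightarrow> True"

fun apply_op :: "'v tt set \<Rightarrow> 'v op \<Rightarrow> 'v tt set" where
  "apply_op S (Join a b) = S - {a, b} \<union> {Node a b}"
| "apply_op S (Split (Node l r)) = S - {Node l r} \<union> {l, r}"
| "apply_op S _ = S"

fun valid_ops :: "'v set set \<Rightarrow> 'v set \<Rightarrow> 'v tt set \<Rightarrow> 'v op list \<Rightarrow> bool" where
  "valid_ops E B S [] \<longleftrightarrow> True"
| "valid_ops E B S (p # os) \<longleftrightarrow> valid_op E B S p \<and> valid_ops E B (apply_op S p) os"

fun is_join_or_split :: "'v op \<Rightarrow> bool" where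
  "is_join_or_split (Join a b) = True"
| "is_join_or_split (Split c) = True"
| "is_join_or_split _ = False"

fun is_return :: "'v op \<Rightarrow> bool" where
  "is_return (Return e) = True"
| "is_return _ = False"

section \<open>Adaptive algorithms interacting with select\<close>

text \<open>An algorithm (strategy) maps the transcript so far (operations issued,
  with the answer of select for Select operations) to the next operation.
  run sel st n is the transcript of the first n operations.\<close>

type_synonym 'v event = "'v op \<times> 'v tt option"

fun run :: "('v tt \<Rightarrow> 'v tt) \<Rightarrow> ('v event list \<Rightarrow> 'v op) \<Rightarrow> nat \<Rightarrow> 'v event list" where
  "run sel st 0 = []"
| "run sel st (Suc n) =
     (let h = run sel st n; p = st h
      in h @ [(p, case p of Select c \<Rightarrow> Some (sel c) | _ \<Rightarrow> None)])"

fun sel_of :: "'v event \<Rightarrow> ('v tt \<times> 'v tt) list" where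
  "sel_of (Select c, Some a) = [(c, a)]"
| "sel_of _ = []"

text \<open>The sequence of select calls (called cluster, selected cluster).\<close>
definition selects :: "'v event list \<Rightarrow> ('v tt \<times> 'v tt) list" where
  "selects tr = concat (map sel_of tr)"

section \<open>The search process\<close>

text \<open>Descent in R: Cs ! 0 = R, each next cluster is a child of the previous one,
  ending with the single edge e.\<close>
definition descent :: "'v tt \<Rightarrow> 'v tt list \<Rightarrow> 'v set \<Rightarrow> bool" where
  "descent R Cs e \<longleftrightarrow> Cs \<noteq> [] \<and> hd Cs = R \<and> last Cs = Leaf e
     \<and> (\<forall>i. Suc i < length Cs \<longrightarrow> (\<exists>A Bc. Cs ! i = Node A Bc \<and> Cs ! Suc i \<in> {A, Bc}))"

text \<open>At step i with current cluster Cs!i having children A, B in R, select is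
  called on the root join(A*,B*) with A \<subseteq> A*, B \<subseteq> B*, A* \<union> B* = T, and the
  new current cluster is A iff A* is selected.\<close>
definition select_step :: "'v set set \<Rightarrow> 'v tt list \<Rightarrow> nat \<Rightarrow> ('v tt \<times> 'v tt) \<Rightarrow> bool" where
  "select_step E Cs i ca \<longleftrightarrow> (\<exists>A Bc As Bs. Cs ! i = Node A Bc \<and> fst ca = Node As Bs
     \<and> edges A \<subseteq> edges As \<and> edges Bc \<subseteq> edges Bs \<and> edges As \<union> edges Bs = E
     \<and> (snd ca = As \<longleftrightarrow> Cs ! Suc i = A))"

definition both_path_children :: "'v set set \<Rightarrow> 'v set \<Rightarrow> 'v tt \<Rightarrow> bool" where
  "both_path_children E B C \<longleftrightarrow> (\<exists>A Bc. C = Node A Bc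
     \<and> path_child E B (edges C) (edges A) \<and> path_child E B (edges C) (edges Bc))"

definition unique_path_child_step :: "'v set set \<Rightarrow> 'v set \<Rightarrow> 'v tt \<Rightarrow> 'v tt \<Rightarrow> bool" where
  "unique_path_child_step E B C C' \<longleftrightarrow> (\<exists>A Bc. C = Node A Bc \<and>
     ((C' = A \<and> path_child E B (edges C) (edges A) \<and> \<not> path_child E B (edges C) (edges Bc))
    \<or> (C' = Bc \<and> path_child E B (edges C) (edges Bc) \<and> \<not> path_child E B (edges C) (edges A))))"

text \<open>search_ok K E B R sel st: run with select function sel, the algorithm st
  halts; all operations are valid on the top forest starting from {R}; the
  transcript is pre @ [Return e] @ post, where pre has at most K*(h+1) calls
  (join/split/select), post consists of at most K*(h+1) joins/splits, and the
  top forest is restored to {R}; the select calls follow the described descent,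
  and e is as claimed.\<close>
definition search_ok :: "nat \<Rightarrow> 'v set set \<Rightarrow> 'v set \<Rightarrow> 'v tt \<Rightarrow> ('v tt \<Rightarrow> 'v tt)
    \<Rightarrow> ('v event list \<Rightarrow> 'v op) \<Rightarrow> bool" where
  "search_ok K E B R sel st \<longleftrightarrow> (\<exists>n e pre post Cs.
     (let tr = run sel st n; ops = map fst tr; ss = selects tr in
       st tr = Stop \<and> Stop \<notin> set ops
     \<and> valid_ops E B {R} ops
     \<and> ops = pre @ [Return e] @ post
     \<and> (\<forall>p\<in>set pre. \<not> is_return p)
     \<and> (\<forall>p\<in>set post. is_join_or_split p)
     \<and> length pre \<le> K * (height R + 1)
     \<and> length post \<le> K * (height R + 1)
     \<and> fold (\<lambda>p S. apply_op S p) ops {R} = {R}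
     \<and> descent R Cs e
     \<and> (if card B \<le> 1 then
          length ss = length Cs - 1
        \<and> (\<forall>i < length ss. select_step E Cs i (ss ! i))
        \<and> e \<in> E
        \<and> (\<forall>ca\<in>set ss. e \<in> edges (snd ca))
        \<and> (\<forall>e'\<in>E. (\<forall>ca\<in>set ss. e' \<in> edges (snd ca)) \<longrightarrow> e' = e)
        else
          (let Is = filter (\<lambda>i. both_path_children E B (Cs ! i)) [0..<length Cs - 1] in
            length ss = length Is
          \<and> (\<forall>j < length Is. select_step E Cs (Is ! j) (ss ! j))
          \<and> (\<forall>i < length Cs - 1. i \<notin> set Is \<longrightarrow> unique_path_child_step E B (Cs ! i) (Cs ! Suc i))
          \<and> (\<forall>x y. B = {x, y} \<longrightarrow>
                e \<in> path_edges E x y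
              \<and> (\<forall>ca\<in>set ss. e \<in> edges (snd ca))
              \<and> (\<forall>e'\<in>path_edges E x y. (\<forall>ca\<in>set ss. e' \<in> edges (snd ca)) \<longrightarrow> e' = e))))))"

end

theory Submission
  imports Defs
begin

text \<open>The search keeps the current cluster \<open>C\<close> as a root cluster, and the rest of the tree in at
  most two further root clusters, one for each boundary vertex of \<open>C\<close>. After \<open>C\<close> is split into
  \<open>A\<close> and \<open>D\<close>, these outer clusters can be distributed over the two children: if both hung only at
  \<open>A\<close>, then \<open>A\<close> would have three boundary vertices. Joining them to their sides gives \<open>A*\<close> and
  \<open>D*\<close>, and after the selection \<open>D*\<close> (or \<open>D*\<close> joined with the outer cluster at the same vertex)
  is an outer cluster of \<open>A\<close>. A level thus costs a bounded number of operations, and each join or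
  split is undone by one split or join.

  All joins are legal because a subtree meeting its complement in one vertex is a cluster as soon
  as it contains at most one external boundary vertex. With two external boundary vertices
  \<open>x\<close> and \<open>y\<close> this holds for every subtree avoiding an edge of the path from \<open>x\<close> to \<open>y\<close>, so the
  search stays at clusters that share an edge with this path. In a tree, the edges of the path are
  those whose deletion separates \<open>x\<close> from \<open>y\<close>, which identifies the cluster path of such a
  cluster as its intersection with the path.\<close>

section \<open>Separation in trees\<close>

definition conn :: "'v set set \<Rightarrow> 'v \<Rightarrow> 'v \<Rightarrow> bool" where
  "conn F u v \<longleftrightarrow> (u, v) \<in> {(a, b). {a, b} \<in> F}\<^sup>*"

lemma conn_on_iff: "conn_on V F \<longleftrightarrow> (\<forall>u\<in>V. \<forall>v\<in>V. conn F u v)"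
  by (simp add: conn_on_def conn_def)

lemma conn_refl [simp]: "conn F u u"
  by (simp add: conn_def)

lemma conn_trans: "conn F u v \<Longrightarrow> conn F v w \<Longrightarrow> conn F u w"
  unfolding conn_def by (rule rtrancl_trans)

lemma conn_edge: "{u, v} \<in> F \<Longrightarrow> conn F u v"
  by (simp add: conn_def r_into_rtrancl)

lemma conn_induct [consumes 1, case_names base step]:
  assumes "conn F u v" "Q u" "\<And>v w. conn F u v \<Longrightarrow> {v, w} \<in> F \<Longrightarrow> Q v \<Longrightarrow> Q w"
  shows "Q v"
  using assms unfolding conn_def by (induction rule: rtrancl_induct) auto

lemma conn_converse_induct [consumes 1, case_names base step]:
  assumes "conn F u v" "Q v" "\<And>u w. {u, w} \<in> F \<Longrightarrow> conn F w v \<Longrightarrow> Q w \<Longrightarrow> Q u"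
  shows "Q u"
  using assms unfolding conn_def by (induction rule: converse_rtrancl_induct) auto

lemma conn_sym: "conn F u v \<Longrightarrow> conn F v u"
proof (induction rule: conn_induct)
  case (step v w)
  then have "conn F w v" by (intro conn_edge) (simp add: insert_commute)
  then show ?case using step.IH by (rule conn_trans)
qed simp

lemma conn_cong: "conn F x u \<Longrightarrow> conn F y v \<Longrightarrow> conn F x y \<longleftrightarrow> conn F u v"
  using conn_trans[of F x u v] conn_trans[of F x v y] conn_trans[of F u x v] conn_trans[of F u y v]
    conn_trans[of F x u y] conn_trans[of F u x y] conn_sym[of F x u] conn_sym[of F y v] by blast

lemma conn_mono: "conn F u v \<Longrightarrow> F \<subseteq> G \<Longrightarrow> conn G u v"
  by (induction rule: conn_induct) (auto intro: conn_trans conn_edge)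

text \<open>A walk can be shortened until it crosses \<open>{a, b}\<close> at most once; the last
  two disjuncts are the two directions of a single crossing.\<close>

lemma conn_delete_edge:
  assumes "conn F u v"
  shows "conn (F - {{a, b}}) u v
    \<or> conn (F - {{a, b}}) u a \<and> conn (F - {{a, b}}) b v
    \<or> conn (F - {{a, b}}) u b \<and> conn (F - {{a, b}}) a v"
  using assms
proof (induction rule: conn_induct)
  case base
  then show ?case by simp
next
  case (step v w)
  then have vw: "{v, w} \<in> F" by blast
  show ?case
  proof (cases "{v, w} = {a, b}")
    case True
    then have "v = a \<and> w = b \<or> v = b \<and> w = a" by (auto simp: doubleton_eq_iff)
    then show ?thesis using step.IH by auto
  next
    case False
    then have "conn (F - {{a, b}}) v w" using vw by (intro conn_edge) auto
    then show ?thesis using step.IH conn_trans[of "F - {{a, b}}" _ v w] by blast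
  qed
qed

text \<open>The walk from \<open>x\<close> towards \<open>c\<close> is stopped just before its first
  edge in \<open>C\<close>. The vertex reached is the gate through which \<open>x\<close> is
  attached to \<open>C\<close>.\<close>

lemma conn_gate:
  assumes "conn E x c" "c \<in> \<Union>C"
  shows "\<exists>u\<in>\<Union>C. conn (E - C) x u"
  using assms(1)
proof (induction rule: conn_converse_induct)
  case base
  then show ?case using assms(2) by (intro bexI[of _ c]) simp_all
next
  case (step x x')
  then obtain u where u: "u \<in> \<Union>C" "conn (E - C) x' u" by blast
  show ?case
  proof (cases "{x, x'} \<in> C")
    case True
    then show ?thesis using conn_refl[of "E - C" x] by blast
  next
    case False
    then have "conn (E - C) x x'" using step.hyps by (intro conn_edge) auto
    then show ?thesis using u conn_trans[of "E - C" x x'] by blast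
  qed
qed

lemma conn_last_edge: "conn F x u \<Longrightarrow> u = x \<or> (\<exists>e\<in>F. u \<in> e)"
  by (induction rule: conn_induct) auto

lemma conn_imp_path:
  assumes "conn F u v"
  shows "\<exists>Q. is_path F Q \<and> hd Q = u \<and> last Q = v"
  using assms
proof (induction rule: conn_induct)
  case base
  have "is_path F [u]" by (simp add: is_path_def)
  then show ?case by force
next
  case (step v w)
  then obtain Q where Q: "is_path F Q" "hd Q = u" "last Q = v" by blast
  show ?case
  proof (cases "w \<in> set Q")
    case True
    then obtain i where i: "i < length Q" "Q ! i = w" by (auto simp: in_set_conv_nth)
    \<comment> \<open>The walk has returned to \<open>w\<close>, so the path is cut back to the
      earlier visit, which keeps its vertices distinct.\<close>
    have "is_path F (take (Suc i) Q)" using Q(1) i by (auto simp: is_path_def)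
    moreover have "hd (take (Suc i) Q) = u" using Q i by (auto simp: is_path_def)
    moreover have "last (take (Suc i) Q) = w" using i by (simp add: take_Suc_conv_app_nth)
    ultimately show ?thesis by blast
  next
    case False
    have "is_path F (Q @ [w])"
      unfolding is_path_def
    proof (intro conjI allI impI)
      show "distinct (Q @ [w])" using Q False by (simp add: is_path_def)
      fix i assume i: "Suc i < length (Q @ [w])"
      show "{(Q @ [w]) ! i, (Q @ [w]) ! Suc i} \<in> F"
      proof (cases "Suc i < length Q")
        case True
        then show ?thesis using Q by (simp add: is_path_def nth_append)
      next
        case False
        then have "length Q = Suc i" using i by simp
        moreover from this have "Q ! i = v" using Q(3) by (metis last_conv_nth diff_Suc_1 list.size(3) nat.distinct(1))
        ultimately show ?thesis using step.hyps by (simp add: nth_append)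
      qed
    qed simp
    moreover have "hd (Q @ [w]) = u" using Q by (simp add: is_path_def)
    ultimately show ?thesis by fastforce
  qed
qed

lemma path_segment_conn:
  assumes "\<And>k. i \<le> k \<Longrightarrow> k < j \<Longrightarrow> {Q ! k, Q ! Suc k} \<in> G" "i \<le> j"
  shows "conn G (Q ! i) (Q ! j)"
  using \<open>i \<le> j\<close> assms(1)
proof (induction j rule: dec_induct)
  case base
  then show ?case by simp
next
  case (step n)
  have "conn G (Q ! i) (Q ! n)" using step by simp
  then show ?case using conn_edge[of "Q ! n" "Q ! Suc n" G] step conn_trans
    by (metis lessI)
qed

section \<open>Acyclic edge sets and the path as a set of separating edges\<close>

definition acyclic_edges :: "'v set set \<Rightarrow> bool" where
  "acyclic_edges F \<longleftrightarrow> (\<forall>a b. {a, b} \<in> F \<longrightarrow> \<not> conn (F - {{a, b}}) a b)"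

text \<open>Bridges stay bridges when edges are removed. The cluster paths need this for the edge
  sets of clusters.\<close>

lemma acyclic_edges_mono: "acyclic_edges E \<Longrightarrow> F \<subseteq> E \<Longrightarrow> acyclic_edges F"
  unfolding acyclic_edges_def by (meson Diff_mono conn_mono in_mono order_refl)

text \<open>A path uses \<open>e\<close> only once, so its two pieces tie \<open>u\<close> and
  \<open>v\<close> to different ends of \<open>e\<close> without using \<open>e\<close>; another
  connection of \<open>u\<close> and \<open>v\<close> would close a cycle through \<open>e\<close>.
  Conversely, a path missing \<open>e\<close> survives its deletion. This trades vertex lists for
  connectivity.\<close>

lemma path_edges_acyclic:
  assumes F: "acyclic_edges F" and uv: "conn F u v"
  shows "path_edges F u v = {e \<in> F. \<not> conn (F - {e}) u v}"
proof (intro set_eqI iffI)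
  fix e assume "e \<in> path_edges F u v"
  then obtain Q i where Q: "is_path F Q" "hd Q = u" "last Q = v"
    and i: "Suc i < length Q" and e: "e = {Q ! i, Q ! Suc i}"
    by (auto simp: path_edges_def)
  have edge: "{Q ! k, Q ! Suc k} \<in> F - {e}" if "Suc k < length Q" "k \<noteq> i" for k
    using that Q(1) i e by (auto simp: is_path_def doubleton_eq_iff nth_eq_iff_index_eq)
  have eF: "e \<in> F" using Q(1) i e by (simp add: is_path_def)
  have Q0: "Q ! 0 = u" "Q ! (length Q - 1) = v"
    using Q by (auto simp: is_path_def hd_conv_nth last_conv_nth)
  have 1: "conn (F - {e}) u (Q ! i)"
    using path_segment_conn[of 0 i Q "F - {e}"] edge i Q0 by simp
  have 2: "conn (F - {e}) (Q ! Suc i) v"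
    using path_segment_conn[of "Suc i" "length Q - 1" Q "F - {e}"] edge i Q0 by simp
  have "\<not> conn (F - {e}) (Q ! i) (Q ! Suc i)" using F eF e by (simp add: acyclic_edges_def)
  then have "\<not> conn (F - {e}) u v" using conn_cong[OF 1 conn_sym[OF 2]] by simp
  then show "e \<in> {e \<in> F. \<not> conn (F - {e}) u v}" using eF by simp
next
  fix e assume e: "e \<in> {e \<in> F. \<not> conn (F - {e}) u v}"
  obtain Q where Q: "is_path F Q" "hd Q = u" "last Q = v" using conn_imp_path[OF uv] by blast
  have Q0: "Q ! 0 = u" "Q ! (length Q - 1) = v" "Q \<noteq> []"
    using Q by (auto simp: is_path_def hd_conv_nth last_conv_nth)
  have "\<exists>i. Suc i < length Q \<and> e = {Q ! i, Q ! Suc i}"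
  proof (rule ccontr)
    assume no: "\<not> ?thesis"
    have "{Q ! k, Q ! Suc k} \<in> F - {e}" if "k < length Q - 1" for k
    proof -
      have "Suc k < length Q" using that by simp
      then show ?thesis using Q(1) no by (auto simp: is_path_def)
    qed
    then have "conn (F - {e}) (Q ! 0) (Q ! (length Q - 1))" by (intro path_segment_conn) auto
    then show False using e Q0 by simp
  qed
  then show "e \<in> path_edges F u v" using Q by (auto simp: path_edges_def)
qed

text \<open>A second connection between the ends of an edge could replace that edge in every walk,
  so deleting it would not disconnect the tree.\<close>

lemma tree_acyclic:
  assumes "is_tree E"
  shows "acyclic_edges E"
  unfolding acyclic_edges_def
proof (intro allI impI notI)
  fix a b assume ab: "{a, b} \<in> E" and c: "conn (E - {{a, b}}) a b"
  have "conn (E - {{a, b}}) u v" if "u \<in> \<Union>E" "v \<in> \<Union>E" for u v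
  proof -
    have "conn E u v" using assms that by (auto simp: is_tree_def conn_on_iff)
    from conn_delete_edge[OF this, of a b] show ?thesis
      using c conn_sym[OF c] conn_trans[of "E - {{a, b}}"] by blast
  qed
  then have "conn_on (\<Union>E) (E - {{a, b}})" by (simp add: conn_on_iff)
  then show False using assms ab by (simp add: is_tree_def)
qed

text \<open>If \<open>e\<close> separates \<open>u\<close> from \<open>v\<close> within
  \<open>C\<close>, then they are still tied to different ends of \<open>e\<close> inside
  \<open>C\<close>; a detour outside of \<open>C\<close> would join those ends and make a
  cycle.\<close>

lemma conn_subtree_delete_edge:
  assumes E: "acyclic_edges E" and C: "C \<subseteq> E" "conn C u v"
    and e: "e \<in> C" "\<exists>a b. e = {a, b}"
  shows "conn (E - {e}) u v \<longleftrightarrow> conn (C - {e}) u v"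
proof
  assume c: "conn (E - {e}) u v"
  obtain a b where ab: "e = {a, b}" using e by blast
  have nab: "\<not> conn (E - {e}) a b" using E C e ab by (auto simp: acyclic_edges_def)
  have up: "conn (C - {e}) p q \<Longrightarrow> conn (E - {e}) p q" for p q
    by (erule conn_mono) (use C in blast)
  show "conn (C - {e}) u v"
  proof (rule ccontr)
    assume "\<not> conn (C - {e}) u v"
    then have "conn (E - {e}) u a \<and> conn (E - {e}) b v \<or> conn (E - {e}) u b \<and> conn (E - {e}) a v"
      using conn_delete_edge[OF C(2), of a b] up ab by metis
    then have "conn (E - {e}) a b"
    proof (elim disjE conjE)
      assume "conn (E - {e}) u a" "conn (E - {e}) b v"
      then show ?thesis
        using c conn_cong[of "E - {e}" u a v b] conn_sym[of "E - {e}" b v] by simp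
    next
      assume "conn (E - {e}) u b" "conn (E - {e}) a v"
      then show ?thesis
        using c conn_cong[of "E - {e}" u b v a] conn_sym[of "E - {e}" a v] conn_sym[of "E - {e}" b a] by simp
    qed
    then show False using nab by simp
  qed
next
  assume "conn (C - {e}) u v"
  then show "conn (E - {e}) u v" by (rule conn_mono) (use C in blast)
qed

text \<open>The vertices \<open>u\<close> and \<open>v\<close> obtained in the proof are the gates
  through which \<open>x\<close> and \<open>y\<close> reach \<open>C\<close>. The walks to them
  avoid \<open>C\<close>, so an edge of \<open>C\<close> separates \<open>x\<close> from
  \<open>y\<close> exactly if it separates the gates, and these turn out to be the two boundary
  vertices.\<close>

lemma cluster_path_tree:
  assumes E: "is_tree E" and B: "B = {x, y}" "B \<subseteq> \<Union>E" and C: "is_cluster E B C"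
    and meets: "C \<inter> path_edges E x y \<noteq> {}"
  shows "card (bd E B C) = 2" "cluster_path E B C = C \<inter> path_edges E x y"
proof -
  have ac: "acyclic_edges E" using E by (rule tree_acyclic)
  have con: "conn E p q" if "p \<in> \<Union>E" "q \<in> \<Union>E" for p q
    using E that by (auto simp: is_tree_def conn_on_iff)
  have CE: "C \<subseteq> E" "C \<noteq> {}" and conC: "\<And>p q. p \<in> \<Union>C \<Longrightarrow> q \<in> \<Union>C \<Longrightarrow> conn C p q"
    using C by (auto simp: is_cluster_def is_subtree_def conn_on_iff)
  have pair: "\<exists>a b. e = {a, b}" if "e \<in> C" for e
  proof -
    have "card e = 2" using E CE that unfolding is_tree_def by blast
    then show ?thesis by (auto simp: card_2_iff)
  qed
  have sep: "e \<in> path_edges E p q \<longleftrightarrow> e \<in> E \<and> \<not> conn (E - {e}) p q"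
    if "p \<in> \<Union>E" "q \<in> \<Union>E" for p q e
    using path_edges_acyclic[OF ac con[OF that]] by simp
  obtain e where e: "e \<in> C" "e \<in> path_edges E x y" using meets by blast
  obtain c where c: "c \<in> \<Union>C" using pair[OF e(1)] e(1) by blast
  have xyE: "x \<in> \<Union>E" "y \<in> \<Union>E" "c \<in> \<Union>E" using B c CE by auto
  obtain u where u: "u \<in> \<Union>C" "conn (E - C) x u" using conn_gate[OF con c] xyE by blast
  obtain v where v: "v \<in> \<Union>C" "conn (E - C) y v" using conn_gate[OF con c] xyE by blast
  have up: "conn (E - C) p q \<Longrightarrow> conn (E - {d}) p q" if "d \<in> C" for p q d
    by (erule conn_mono) (use that in blast)
  \<comment> \<open>With a common gate, \<open>x\<close> and \<open>y\<close> would be connected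
    outside of \<open>C\<close>, hence without the path edge \<open>e\<close>, which lies in
    \<open>C\<close>.\<close>
  have uv: "u \<noteq> v"
  proof
    assume "u = v"
    then have "conn (E - {e}) x y"
      using up[OF e(1) u(2)] conn_sym[OF up[OF e(1) v(2)]] by (auto intro: conn_trans)
    then show False using e sep[OF xyE(1,2)] by simp
  qed
  \<comment> \<open>A gate is either the external vertex itself or the end of a last edge outside of
    \<open>C\<close>.\<close>
  have ubd: "u \<in> bd E B C" "v \<in> bd E B C"
    using conn_last_edge[OF u(2)] conn_last_edge[OF v(2)] u v B by (auto simp: bd_def)
  have "\<Union>C \<subseteq> \<Union>E" using CE by blast
  moreover have "finite (\<Union>E)"
    using E by (intro finite_Union) (auto simp: is_tree_def intro: card_ge_0_finite)
  ultimately have fin: "finite (bd E B C)" by (auto simp: bd_def intro: finite_subset)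
  have "bd E B C = {u, v}"
  proof (rule card_subset_eq[OF fin, symmetric])
    have "card (bd E B C) \<le> 2" using C by (simp add: is_cluster_def)
    moreover have "card {u, v} \<le> card (bd E B C)" using ubd fin by (intro card_mono) auto
    ultimately show "card {u, v} = card (bd E B C)" using uv by simp
  qed (use ubd in auto)
  then show "card (bd E B C) = 2" using uv by simp
  have key: "path_edges C p q = C \<inter> path_edges E x y" if pq: "{p, q} = {u, v}" for p q
  proof (rule set_eqI)
    fix d
    have pqC: "p \<in> \<Union>C" "q \<in> \<Union>C" using pq u(1) v(1) by (auto simp: doubleton_eq_iff)
    have 1: "path_edges C p q = {e \<in> C. \<not> conn (C - {e}) p q}"
      by (rule path_edges_acyclic[OF acyclic_edges_mono[OF ac CE(1)] conC[OF pqC]])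
    have "conn (E - {d}) x y \<longleftrightarrow> conn (C - {d}) p q" if d: "d \<in> C"
    proof -
      have "conn (E - {d}) x y \<longleftrightarrow> conn (E - {d}) u v"
        by (rule conn_cong[OF up[OF d u(2)] up[OF d v(2)]])
      also have "\<dots> \<longleftrightarrow> conn (E - {d}) p q"
        using pq conn_sym[of "E - {d}" u v] conn_sym[of "E - {d}" v u] by (auto simp: doubleton_eq_iff)
      also have "\<dots> \<longleftrightarrow> conn (C - {d}) p q"
        by (rule conn_subtree_delete_edge[OF ac CE(1) conC[OF pqC] d pair[OF d]])
      finally show ?thesis .
    qed
    then show "d \<in> path_edges C p q \<longleftrightarrow> d \<in> C \<inter> path_edges E x y"
      using 1 sep[OF xyE(1,2)] CE by auto
  qed
  show "cluster_path E B C = C \<inter> path_edges E x y"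
  proof (intro set_eqI iffI)
    fix d assume "d \<in> cluster_path E B C"
    then obtain p q where "bd E B C = {p, q}" "d \<in> path_edges C p q"
      unfolding cluster_path_def by blast
    then show "d \<in> C \<inter> path_edges E x y" using key \<open>bd E B C = {u, v}\<close> by metis
  next
    fix d assume "d \<in> C \<inter> path_edges E x y"
    then have "d \<in> path_edges C u v" using key[of u v] by simp
    then show "d \<in> cluster_path E B C"
      unfolding cluster_path_def using \<open>bd E B C = {u, v}\<close> uv by blast
  qed
qed

section \<open>Top forests\<close>

abbreviation verts :: "'v tt \<Rightarrow> 'v set" where
  "verts T \<equiv> \<Union>(edges T)"

lemma edges_nonempty [simp]: "edges T \<noteq> {}"
  by (induction T) auto

lemma node_neq: "a \<noteq> Node a b" "b \<noteq> Node a b"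
  by (auto dest: arg_cong[of _ _ size])

lemma conn_on_Un:
  assumes "conn_on (\<Union>F) F" "conn_on (\<Union>G) G" "\<Union>F \<inter> \<Union>G \<noteq> {}"
  shows "conn_on (\<Union>(F \<union> G)) (F \<union> G)"
proof -
  obtain m where m: "m \<in> \<Union>F" "m \<in> \<Union>G" using assms(3) by blast
  have "conn (F \<union> G) u m" if "u \<in> \<Union>(F \<union> G)" for u
  proof (cases "u \<in> \<Union>F")
    case True
    then have "conn F u m" using assms(1) m unfolding conn_on_iff by blast
    then show ?thesis by (rule conn_mono) simp
  next
    case False
    then have "conn G u m" using assms(2) m that unfolding conn_on_iff by blast
    then show ?thesis by (rule conn_mono) simp
  qed
  then show ?thesis unfolding conn_on_iff by (blast intro: conn_sym conn_trans)
qed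

lemma is_subtree_Un:
  "is_subtree E F \<Longrightarrow> is_subtree E G \<Longrightarrow> \<Union>F \<inter> \<Union>G \<noteq> {} \<Longrightarrow> is_subtree E (F \<union> G)"
  unfolding is_subtree_def using conn_on_Un[of F G] by blast

text \<open>\<open>external\<close> is the only fact about the candidate edges \<open>P\<close> on
  which the legality of the joins rests: as long as some cluster holds a candidate edge, every
  subtree disjoint from it has at most one external boundary vertex. Both cases of the theorem are
  instances.\<close>

locale top_tree_search =
  fixes E :: "'v set set" and B :: "'v set" and P :: "'v set set"
  assumes finE: "finite E" and card_edge: "\<And>e. e \<in> E \<Longrightarrow> card e = 2"
    and finB: "finite B" and cardB: "card B \<le> 2"
    and external: "\<And>A F. A \<inter> P \<noteq> {} \<Longrightarrow> is_subtree E F \<Longrightarrow> F \<inter> A = {} \<Longrightarrow> card (B \<inter> \<Union>F) \<le> 1"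
begin

lemma finite_verts_E: "finite (\<Union>E)"
  using finE card_edge by (intro finite_Union) (auto intro: card_ge_0_finite)

lemma valid_tt_cluster: "valid_tt E B T \<Longrightarrow> is_cluster E B (edges T)"
proof (cases T)
  case (Leaf e)
  assume "valid_tt E B T"
  then have e: "e \<in> E" "card e = 2" using Leaf card_edge by auto
  then obtain a b where ab: "e = {a, b}" by (auto simp: card_2_iff)
  have "finite e" using e(2) by (intro card_ge_0_finite) simp
  then have "card (bd E B {e}) \<le> 2" using e(2) card_mono[of e "bd E B {e}"] by (auto simp: bd_def)
  moreover have "conn_on (\<Union>{e}) {e}"
    using conn_edge[of a b "{e}"] conn_edge[of b a "{e}"] ab by (auto simp: conn_on_iff insert_commute)
  ultimately show ?thesis using Leaf e by (simp add: is_cluster_def is_subtree_def)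
qed simp

lemma clusterI:
  assumes "is_subtree E F" "\<Union>F \<inter> \<Union>(E - F) \<subseteq> {m}" "card (B \<inter> \<Union>F) \<le> 1"
  shows "is_cluster E B F"
proof -
  have "bd E B F \<subseteq> insert m (B \<inter> \<Union>F)" using assms(2) by (auto simp: bd_def)
  then have "card (bd E B F) \<le> card (insert m (B \<inter> \<Union>F))" using finB by (intro card_mono) auto
  also have "\<dots> \<le> 2" using assms(3) finB by (simp add: card_insert_if)
  finally show ?thesis using assms(1) by (simp add: is_cluster_def)
qed

section \<open>Top forests and reversible moves\<close>

definition forest :: "'v tt set \<Rightarrow> bool" where
  "forest S \<longleftrightarrow> (\<forall>T\<in>S. valid_tt E B T) \<and> (\<forall>T\<in>S. \<forall>U\<in>S. T \<noteq> U \<longrightarrow> edges T \<inter> edges U = {})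
     \<and> \<Union>(edges ` S) = E"

lemma forest_subtree: "forest S \<Longrightarrow> T \<in> S \<Longrightarrow> is_subtree E (edges T)"
  using valid_tt_cluster by (auto simp: forest_def is_cluster_def)

lemma forest_disjoint: "forest S \<Longrightarrow> T \<in> S \<Longrightarrow> U \<in> S \<Longrightarrow> T \<noteq> U \<Longrightarrow> edges T \<inter> edges U = {}"
  by (auto simp: forest_def)

text \<open>Roots are edge-disjoint, and \<open>Node a b\<close> shares edges with \<open>a\<close>.
  As forests are sets, this ensures that splitting the joined cluster restores exactly the old
  set.\<close>

lemma forest_join_fresh:
  assumes "forest S" "a \<in> S" "b \<in> S"
  shows "Node a b \<notin> S"
proof
  assume "Node a b \<in> S"
  then have "edges (Node a b) \<inter> edges a = {}" using assms forest_disjoint node_neq by metis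
  then show False by (simp add: Int_Un_distrib2)
qed

definition moves :: "'v tt set \<Rightarrow> 'v op list \<Rightarrow> 'v tt set \<Rightarrow> bool" where
  "moves S ps S' \<longleftrightarrow> valid_ops E B S ps \<and> fold (\<lambda>p S. apply_op S p) ps S = S'
     \<and> (\<forall>p\<in>set ps. is_join_or_split p)"

lemma valid_ops_append:
  "valid_ops E B S (ps @ qs) \<longleftrightarrow>
     valid_ops E B S ps \<and> valid_ops E B (fold (\<lambda>p S. apply_op S p) ps S) qs"
  by (induction ps arbitrary: S) auto

lemma moves_append: "moves S ps S' \<Longrightarrow> moves S' qs S'' \<Longrightarrow> moves S (ps @ qs) S''"
  by (auto simp: moves_def valid_ops_append)

text \<open>Both directions are counted together, since every change of the forest must later be
  undone at a bounded cost.\<close>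

definition within :: "nat \<Rightarrow> 'v tt set \<Rightarrow> 'v tt set \<Rightarrow> bool" where
  "within n S S' \<longleftrightarrow> (\<exists>ps. moves S ps S' \<and> length ps \<le> n) \<and> (\<exists>ps. moves S' ps S \<and> length ps \<le> n)"

lemma within_sym: "within n S S' \<Longrightarrow> within n S' S"
  by (auto simp: within_def)

lemma within_refl: "within n S S"
proof -
  have "moves S [] S" by (simp add: moves_def)
  then show ?thesis unfolding within_def by force
qed

lemma within_trans:
  assumes "within k S S'" "within n S' S''"
  shows "within (k + n) S S''"
proof -
  obtain ps ps' qs qs' where
    "moves S ps S'" "length ps \<le> k" "moves S' ps' S" "length ps' \<le> k"
    "moves S' qs S''" "length qs \<le> n" "moves S'' qs' S'" "length qs' \<le> n"
    using assms by (auto simp: within_def)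
  then have "moves S (ps @ qs) S''" "length (ps @ qs) \<le> k + n"
    "moves S'' (qs' @ ps') S" "length (qs' @ ps') \<le> k + n"
    using moves_append by auto
  then show ?thesis unfolding within_def by blast
qed

lemma within_join:
  assumes S: "forest S" and ab: "a \<in> S" "b \<in> S" "a \<noteq> b"
    and m: "card (verts a \<inter> verts b) = 1" and cl: "is_cluster E B (edges a \<union> edges b)"
  shows "forest (S - {a, b} \<union> {Node a b})" "within 1 S (S - {a, b} \<union> {Node a b})"
proof -
  have d: "edges a \<inter> edges b = {}" using forest_disjoint[OF S ab] .
  have da: "edges T \<inter> edges a = {}" "edges T \<inter> edges b = {}" if "T \<in> S - {a, b}" for T
    using forest_disjoint[OF S] ab that by auto
  have v: "valid_tt E B (Node a b)" using S ab m cl d by (auto simp: forest_def)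
  show "forest (S - {a, b} \<union> {Node a b})"
    unfolding forest_def
  proof (intro conjI ballI impI)
    show "valid_tt E B T" if "T \<in> S - {a, b} \<union> {Node a b}" for T
      using that S v by (auto simp: forest_def)
    show "edges T \<inter> edges U = {}"
      if TU: "T \<in> S - {a, b} \<union> {Node a b}" "U \<in> S - {a, b} \<union> {Node a b}" "T \<noteq> U" for T U
    proof -
      show ?thesis
      proof (cases "T = Node a b")
        case True
        then show ?thesis using da[of U] TU by auto
      next
        case T: False
        show ?thesis
        proof (cases "U = Node a b")
          case True
          then show ?thesis using da[of T] TU T by auto
        next
          case False
          then show ?thesis using forest_disjoint[OF S _ _ TU(3)] TU T by blast
        qed
      qed
    qed
    show "\<Union>(edges ` (S - {a, b} \<union> {Node a b})) = E"
    proof -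
      have "S - {a, b} \<union> {a, b} = S" using ab by blast
      moreover have "\<Union>(edges ` (S - {a, b} \<union> {Node a b})) = \<Union>(edges ` (S - {a, b} \<union> {a, b}))"
        unfolding image_Un Union_Un_distrib by simp
      moreover have "\<Union>(edges ` S) = E" using S unfolding forest_def by blast
      ultimately show ?thesis by metis
    qed
  qed
  let ?S' = "S - {a, b} \<union> {Node a b}"
  have "moves S [Join a b] ?S'" using S ab m cl d by (simp add: moves_def)
  moreover have "moves ?S' [Split (Node a b)] S"
    using ab forest_join_fresh[OF S ab(1,2)] by (auto simp: moves_def)
  ultimately show "within 1 S ?S'" unfolding within_def by fastforce
qed

lemma within_split:
  assumes S: "forest S" and ab: "Node a b \<in> S"
  shows "forest (S - {Node a b} \<union> {a, b})" "within 1 S (S - {Node a b} \<union> {a, b})"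
proof -
  let ?S' = "S - {Node a b} \<union> {a, b}"
  have v: "valid_tt E B (Node a b)" using S ab unfolding forest_def by blast
  then have ab_disj: "edges a \<inter> edges b = {}" by simp
  have d: "edges T \<inter> edges a = {}" "edges T \<inter> edges b = {}" if "T \<in> S - {Node a b}" for T
    using forest_disjoint[OF S _ ab] that by auto
  show S': "forest ?S'"
    unfolding forest_def
  proof (intro conjI ballI impI)
    show "valid_tt E B T" if "T \<in> ?S'" for T using that S v by (auto simp: forest_def)
    show "edges T \<inter> edges U = {}" if "T \<in> ?S'" "U \<in> ?S'" "T \<noteq> U" for T U
      using that d forest_disjoint[OF S] ab_disj by blast
    show "\<Union>(edges ` ?S') = E"
    proof -
      have "S - {Node a b} \<union> {Node a b} = S" using ab by blast
      moreover have "\<Union>(edges ` ?S') = \<Union>(edges ` (S - {Node a b} \<union> {Node a b}))"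
        unfolding image_Un Union_Un_distrib by simp
      moreover have "\<Union>(edges ` S) = E" using S unfolding forest_def by blast
      ultimately show ?thesis by metis
    qed
  qed
  have "a \<noteq> b" using v by auto
  moreover have "a \<notin> S" "b \<notin> S"
    using forest_disjoint[OF S _ ab] node_neq by (metis Int_absorb2 Un_upper1 Un_upper2 edges.simps(2) edges_nonempty)+
  \<comment> \<open>The split is the inverse of a join in the split forest. As neither child was a
    root before, removing both and putting back the parent gives precisely \<open>S\<close>.\<close>
  ultimately have "within 1 ?S' (?S' - {a, b} \<union> {Node a b})"
    using v by (intro within_join[OF S']) auto
  moreover have "?S' - {a, b} \<union> {Node a b} = S"
    using ab \<open>a \<notin> S\<close> \<open>b \<notin> S\<close> by auto
  ultimately show "within 1 S ?S'" using within_sym by simp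
qed

section \<open>Moves for one level of the search\<close>

definition at_most_one :: "'a set \<Rightarrow> bool" where
  "at_most_one X \<longleftrightarrow> (\<forall>x\<in>X. \<forall>y\<in>X. x = y)"

lemma at_most_one_cases:
  assumes "at_most_one X"
  obtains "X = {}" | x where "X = {x}"
  using assms unfolding at_most_one_def by blast

lemma at_most_one_simps [simp]: "at_most_one {}" "at_most_one {x}"
  by (auto simp: at_most_one_def)

definition attached :: "'v tt \<Rightarrow> 'v tt \<Rightarrow> bool" where
  "attached X T \<longleftrightarrow> (\<exists>c. verts X \<inter> verts T = {c})"

lemma attached_sym: "attached X T \<Longrightarrow> attached T X"
  by (simp add: attached_def Int_commute)

text \<open>The new cluster can meet the other roots only in \<open>m\<close>, and the candidate
  edge in \<open>A\<close> stays outside of it, so \<open>external\<close> leaves room for at most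
  one further boundary vertex.\<close>

lemma join_attached:
  assumes S: "forest S" and ab: "a \<in> S" "b \<in> S" "a \<noteq> b" "attached a b"
    and rest: "\<And>T. T \<in> S \<Longrightarrow> T \<noteq> a \<Longrightarrow> T \<noteq> b \<Longrightarrow> verts T \<inter> (verts a \<union> verts b) \<subseteq> {m}"
    and ext: "A \<inter> P \<noteq> {}" "A \<inter> (edges a \<union> edges b) = {}"
  shows "forest (S - {a, b} \<union> {Node a b})" "within 1 S (S - {a, b} \<union> {Node a b})"
proof -
  let ?F = "edges a \<union> edges b"
  have "is_subtree E (edges a)" "is_subtree E (edges b)" using forest_subtree S ab by auto
  moreover have "verts a \<inter> verts b \<noteq> {}" using ab by (auto simp: attached_def)
  ultimately have sub: "is_subtree E ?F" by (rule is_subtree_Un)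
  have "e \<in> \<Union>(edges ` (S - {a, b}))" if "e \<in> E - ?F" for e
    using S that by (auto simp: forest_def)
  then have "\<Union>?F \<inter> \<Union>(E - ?F) \<subseteq> {m}" using rest by fastforce
  then have "is_cluster E B ?F" using sub external[OF ext(1) sub] ext(2) by (intro clusterI) auto
  moreover have "card (verts a \<inter> verts b) = 1" using ab by (auto simp: attached_def)
  ultimately show "forest (S - {a, b} \<union> {Node a b})" "within 1 S (S - {a, b} \<union> {Node a b})"
    using within_join[OF S ab(1-3)] by auto
qed

text \<open>The state of the search at a current cluster \<open>C\<close>: the remainder of the tree is
  held in at most two vertex-disjoint root clusters, each glued to \<open>C\<close> at one vertex.\<close>

definition state :: "'v tt set \<Rightarrow> 'v tt \<Rightarrow> 'v tt set \<Rightarrow> bool" where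
  "state S C Os \<longleftrightarrow> forest S \<and> S = insert C Os \<and> C \<notin> Os
     \<and> (\<exists>X Y. Os \<subseteq> {X, Y}) \<and> (\<forall>X\<in>Os. attached X C)
     \<and> (\<forall>X\<in>Os. \<forall>Y\<in>Os. X \<noteq> Y \<longrightarrow> verts X \<inter> verts Y = {})"

text \<open>The same after splitting \<open>C\<close> into \<open>A\<close> and \<open>D\<close>, with the outer clusters
  distributed over the two children.\<close>

definition halves :: "'v tt set \<Rightarrow> 'v tt \<Rightarrow> 'v tt \<Rightarrow> 'v tt set \<Rightarrow> 'v tt set \<Rightarrow> bool" where
  "halves S A D OA OD \<longleftrightarrow> forest S \<and> S = insert A (insert D (OA \<union> OD))
     \<and> A \<noteq> D \<and> A \<notin> OA \<union> OD \<and> D \<notin> OA \<union> OD \<and> OA \<inter> OD = {}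
     \<and> at_most_one OA \<and> at_most_one OD \<and> attached A D
     \<and> (\<forall>X\<in>OA. attached X A \<and> verts X \<inter> verts D \<subseteq> verts A)
     \<and> (\<forall>X\<in>OD. attached X D \<and> verts X \<inter> verts A \<subseteq> verts D)
     \<and> (\<forall>X\<in>OA. \<forall>Y\<in>OD. verts X \<inter> verts Y = {})"

lemma halves_sym: "halves S A D OA OD \<Longrightarrow> halves S D A OD OA"
proof -
  assume h: "halves S A D OA OD"
  then have "\<forall>X\<in>OD. \<forall>Y\<in>OA. verts X \<inter> verts Y = {}"
    unfolding halves_def by (metis Int_commute)
  moreover have "attached D A" using h attached_sym unfolding halves_def by blast
  moreover have "S = insert D (insert A (OD \<union> OA))" using h unfolding halves_def by auto
  moreover have "OD \<inter> OA = {}" "D \<noteq> A" using h unfolding halves_def by auto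
  ultimately show "halves S D A OD OA"
    using h unfolding halves_def by blast
qed

text \<open>The outer cluster at \<open>D\<close>, if any, is joined to \<open>D\<close>. The result
  meets the other roots at most in the vertex \<open>m\<close> common to \<open>A\<close> and
  \<open>D\<close>: an outer cluster of one child meets the other child only in vertices of its own
  child, and outer clusters of different children are disjoint. The candidate edge of
  \<open>A\<close> remains outside.\<close>

lemma absorb_outer:
  assumes h: "halves S A D OA OD" and A: "edges A \<inter> P \<noteq> {}"
  shows "\<exists>S' D'. within 1 S S' \<and> halves S' A D' OA {} \<and> edges D \<subseteq> edges D'"
proof -
  have S: "forest S" "S = insert A (insert D (OA \<union> OD))" and neq: "A \<noteq> D" "A \<notin> OA \<union> OD" "D \<notin> OA \<union> OD" "OA \<inter> OD = {}"
    and att: "attached A D" "\<And>X. X \<in> OA \<Longrightarrow> attached X A" "\<And>X. X \<in> OD \<Longrightarrow> attached X D"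
    and sub: "\<And>X. X \<in> OA \<Longrightarrow> verts X \<inter> verts D \<subseteq> verts A" "\<And>X. X \<in> OD \<Longrightarrow> verts X \<inter> verts A \<subseteq> verts D"
    and dis: "\<And>X Y. X \<in> OA \<Longrightarrow> Y \<in> OD \<Longrightarrow> verts X \<inter> verts Y = {}"
    and one: "at_most_one OA" "at_most_one OD"
    using h unfolding halves_def by auto
  from one(2) show ?thesis
  proof (cases rule: at_most_one_cases)
    case 1
    then show ?thesis using h within_refl by blast
  next
    case (2 X)
    obtain m where m: "verts A \<inter> verts D = {m}" using att(1) by (auto simp: attached_def)
    let ?S' = "S - {D, X} \<union> {Node D X}"
    have DX: "D \<in> S" "X \<in> S" "D \<noteq> X" "attached D X" "A \<in> S"
      using S(2) 2 neq att(3)[of X] attached_sym by auto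
    have "verts T \<inter> (verts D \<union> verts X) \<subseteq> {m}" if "T \<in> S" "T \<noteq> D" "T \<noteq> X" for T
    proof (cases "T = A")
      case True
      then show ?thesis using sub(2)[of X] 2 m by blast
    next
      case False
      then have "T \<in> OA" using that S(2) 2 by auto
      then show ?thesis using sub(1)[of T] dis[of T X] 2 m by blast
    qed
    moreover have "edges A \<inter> (edges D \<union> edges X) = {}"
      using forest_disjoint[OF S(1) \<open>A \<in> S\<close>] DX neq 2 by (metis Int_Un_distrib Un_empty_left UnI2 singletonI)
    ultimately have j: "forest ?S'" "within 1 S ?S'"
      using join_attached[OF S(1) DX(1-4) _ A, of m] by blast+
    have fresh: "Node D X \<notin> S" using forest_join_fresh[OF S(1)] DX by auto
    have eq: "?S' = insert A (insert (Node D X) OA)" using S(2) neq 2 DX by auto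
    have "attached A (Node D X)" using m sub(2)[of X] 2 by (auto simp: attached_def Int_Un_distrib Union_Un_distrib)
    moreover have "verts Z \<inter> verts (Node D X) \<subseteq> verts A" if "Z \<in> OA" for Z
      using sub(1)[OF that] dis[OF that, of X] 2 by auto
    ultimately have "halves ?S' A (Node D X) OA {}"
      using j(1) eq fresh S(2) neq one att(2) unfolding halves_def by auto
    then show ?thesis using j(2) by fastforce
  qed
qed

text \<open>\<open>D\<close> becomes an outer cluster of \<open>A\<close>, so it must be
  vertex-disjoint from an outer cluster \<open>X\<close> already there. If it is not, all three meet
  in the vertex \<open>m\<close>, and \<open>X\<close> and \<open>D\<close> are joined into one
  outer cluster.\<close>

lemma halves_state:
  assumes h: "halves S A D OA {}" and A: "edges A \<inter> P \<noteq> {}"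
  shows "\<exists>S' Os. within 1 S S' \<and> state S' A Os"
proof -
  have S: "forest S" "S = insert A (insert D OA)" and neq: "A \<noteq> D" "A \<notin> OA" "D \<notin> OA"
    and att: "attached A D" "\<And>X. X \<in> OA \<Longrightarrow> attached X A"
    and sub: "\<And>X. X \<in> OA \<Longrightarrow> verts X \<inter> verts D \<subseteq> verts A"
    and one: "at_most_one OA"
    using h unfolding halves_def by auto
  obtain m where m: "verts A \<inter> verts D = {m}" using att(1) by (auto simp: attached_def)
  from one show ?thesis
  proof (cases rule: at_most_one_cases)
    case 1
    then have "state S A {D}" using S neq att attached_sym by (auto simp: state_def)
    then show ?thesis using within_refl by blast
  next
    case (2 X)
    show ?thesis
    proof (cases "verts X \<inter> verts D = {}")
      case True
      then have "state S A {X, D}" using S neq att attached_sym 2 by (auto simp: state_def Int_commute)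
      then show ?thesis using within_refl by blast
    next
      case False
      let ?S' = "S - {X, D} \<union> {Node X D}"
      have XD: "X \<in> S" "D \<in> S" "X \<noteq> D" "A \<in> S" using S(2) 2 neq by auto
      have m': "verts X \<inter> verts D = {m}" 
      proof -
        have "verts X \<inter> verts D \<subseteq> verts A \<inter> verts D" using sub[of X] 2 by simp
        then show ?thesis using False m by (simp add: subset_singleton_iff)
      qed
      obtain c where "verts X \<inter> verts A = {c}" using att(2)[of X] 2 by (auto simp: attached_def)
      moreover have "m \<in> verts X \<inter> verts A" using m m' by (metis Int_iff insertI1)
      ultimately have c: "verts X \<inter> verts A = {m}" by (metis singletonD)
      have "verts T \<inter> (verts X \<union> verts D) \<subseteq> {m}" if "T \<in> S" "T \<noteq> X" "T \<noteq> D" for T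
      proof -
        have "T = A" using that S(2) 2 by auto
        then show ?thesis using m c by (simp add: Int_Un_distrib Int_commute)
      qed
      moreover have "edges A \<inter> (edges X \<union> edges D) = {}"
        using forest_disjoint[OF S(1) \<open>A \<in> S\<close>] XD neq 2 by (metis Int_Un_distrib Un_empty_left singletonI)
      moreover have "attached X D" using m' by (simp add: attached_def)
      ultimately have j: "forest ?S'" "within 1 S ?S'"
        using join_attached[OF S(1) XD(1-3) _ _ A, of m] by blast+
      have fresh: "Node X D \<notin> S" using forest_join_fresh[OF S(1)] XD by auto
      have eq: "?S' = {A, Node X D}" using S(2) neq 2 XD by auto
      have "verts (Node X D) \<inter> verts A = {m}" using m c by auto
      then have "attached (Node X D) A" unfolding attached_def by blast
      then have "state ?S' A {Node X D}" using j(1) eq fresh XD by (auto simp: state_def)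
      then show ?thesis using j(2) by blast
    qed
  qed
qed

lemma descend:
  assumes "halves S A D OA OD" "edges A \<inter> P \<noteq> {}"
  shows "\<exists>S' Os. within 2 S S' \<and> state S' A Os"
proof -
  obtain S1 D' where 1: "within 1 S S1" "halves S1 A D' OA {}" using absorb_outer[OF assms] by blast
  obtain S2 Os where "within 1 S1 S2" "state S2 A Os" using halves_state[OF 1(2) assms(2)] by blast
  then show ?thesis using within_trans[OF 1(1), of 1 S2] by (auto simp: numeral_2_eq_2)
qed

text \<open>At most two joins absorb the outer clusters into the two sides; each needs a candidate
  edge on the opposite side, which the children supply. The last join covers all of
  \<open>E\<close>, whose boundary lies in \<open>B\<close>.\<close>

lemma join_to_root:
  assumes h: "halves S A D OA OD" and A: "edges A \<inter> P \<noteq> {}" and D: "edges D \<inter> P \<noteq> {}"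
  shows "\<exists>As Ds. within 3 S {Node As Ds} \<and> edges A \<subseteq> edges As \<and> edges D \<subseteq> edges Ds
    \<and> edges As \<union> edges Ds = E \<and> edges As \<inter> edges Ds = {}"
proof -
  obtain S1 Ds where 1: "within 1 S S1" "halves S1 A Ds OA {}" "edges D \<subseteq> edges Ds"
    using absorb_outer[OF h A] by blast
  have "edges Ds \<inter> P \<noteq> {}" using D 1(3) by blast
  then obtain S2 As where 2: "within 1 S1 S2" "halves S2 Ds As {} {}" "edges A \<subseteq> edges As"
    using absorb_outer[OF halves_sym[OF 1(2)]] by blast
  have S2: "forest S2" "S2 = {As, Ds}" "As \<noteq> Ds" "attached As Ds"
    using 2(2) attached_sym by (auto simp: halves_def)
  have E: "edges As \<union> edges Ds = E" using S2 by (simp add: forest_def)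
  have "is_subtree E (edges As)" "is_subtree E (edges Ds)" using forest_subtree S2 by auto
  moreover have "verts As \<inter> verts Ds \<noteq> {}" using S2 by (auto simp: attached_def)
  ultimately have sub: "is_subtree E E" using is_subtree_Un E by metis
  have "bd E B E \<subseteq> B" by (auto simp: bd_def)
  then have "card (bd E B E) \<le> 2" using cardB card_mono[OF finB] le_trans by blast
  then have "within 1 S2 (S2 - {As, Ds} \<union> {Node As Ds})"
    using S2 sub E by (intro within_join) (auto simp: attached_def is_cluster_def)
  then have "within 1 S2 {Node As Ds}" using S2 by simp
  then have "within 3 S {Node As Ds}"
    using within_trans[OF within_trans[OF 1(1) 2(1)], of 1 "{Node As Ds}"] by (simp add: numeral_3_eq_3)
  moreover have "edges As \<inter> edges Ds = {}" using forest_disjoint[OF S2(1)] S2 by simp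
  ultimately show ?thesis using 1(3) 2(3) E by blast
qed

lemma state_split:
  assumes "state S (Node A D) Os"
  shows "\<exists>S' OA OD. within 1 S S' \<and> halves S' A D OA OD"
proof -
  let ?C = "Node A D" and ?S' = "S - {Node A D} \<union> {A, D}"
  have S: "forest S" "S = insert ?C Os" "?C \<notin> Os" and two: "\<exists>X Y. Os \<subseteq> {X, Y}"
    and att: "\<And>X. X \<in> Os \<Longrightarrow> attached X ?C"
    and dis: "\<And>X Y. X \<in> Os \<Longrightarrow> Y \<in> Os \<Longrightarrow> X \<noteq> Y \<Longrightarrow> verts X \<inter> verts Y = {}"
    using assms unfolding state_def by auto
  have S': "forest ?S'" "within 1 S ?S'" using within_split[OF S(1), of A D] S(2) by blast+
  have v: "valid_tt E B ?C" using S by (auto simp: forest_def)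
  then obtain m where m: "verts A \<inter> verts D = {m}" by (auto simp: card_1_singleton_iff)
  have AD: "A \<noteq> D" "attached A D" using v m by (auto simp: attached_def)
  have nOs: "A \<notin> Os" "D \<notin> Os"
    using forest_disjoint[OF S(1), of _ ?C] S(2) node_neq
    by (metis Int_absorb2 Un_upper1 Un_upper2 edges.simps(2) edges_nonempty insertCI)+
  \<comment> \<open>Any assignment of the outer clusters to children they touch works, provided that
    no child receives two.\<close>
  have glue: "halves ?S' A D OA OD"
    if O: "Os = OA \<union> OD" "OA \<inter> OD = {}" "at_most_one OA" "at_most_one OD"
      and OA: "\<And>X. X \<in> OA \<Longrightarrow> verts X \<inter> verts A \<noteq> {}"
      and OD: "\<And>X. X \<in> OD \<Longrightarrow> verts X \<inter> verts D \<noteq> {}" for OA OD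
  proof -
    \<comment> \<open>\<open>X\<close> meets the unsplit cluster in a single vertex, so if it
      touches both children, it does so in this one vertex.\<close>
    have pt: "\<exists>c. verts X \<inter> verts A \<subseteq> {c} \<and> verts X \<inter> verts D \<subseteq> {c}" if X: "X \<in> Os" for X
    proof -
      obtain c where c: "verts X \<inter> verts ?C = {c}" using att[OF X] unfolding attached_def by blast
      have "verts A \<subseteq> verts ?C" "verts D \<subseteq> verts ?C" by auto
      then show ?thesis using c by (metis Int_mono order_refl)
    qed
    have "attached X A \<and> verts X \<inter> verts D \<subseteq> verts A" if X: "X \<in> OA" for X
    proof -
      obtain c where c: "verts X \<inter> verts A \<subseteq> {c}" "verts X \<inter> verts D \<subseteq> {c}" using pt[of X] O(1) X by blast
      then have "verts X \<inter> verts A = {c}" using OA[OF X] by (simp add: subset_singleton_iff)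
      then show ?thesis using c(2) unfolding attached_def by (metis Int_lower2 subset_trans)
    qed
    moreover have "attached X D \<and> verts X \<inter> verts A \<subseteq> verts D" if X: "X \<in> OD" for X
    proof -
      obtain c where c: "verts X \<inter> verts A \<subseteq> {c}" "verts X \<inter> verts D \<subseteq> {c}" using pt[of X] O(1) X by blast
      then have "verts X \<inter> verts D = {c}" using OD[OF X] by (simp add: subset_singleton_iff)
      then show ?thesis using c(1) unfolding attached_def by (metis Int_lower2 subset_trans)
    qed
    moreover have "verts X \<inter> verts Y = {}" if "X \<in> OA" "Y \<in> OD" for X Y
      using that O dis by blast
    moreover have "?S' = insert A (insert D (OA \<union> OD))" using S O by auto
    ultimately show ?thesis using S'(1) AD nOs O unfolding halves_def by auto
  qed
  have meets: "verts X \<inter> verts A \<noteq> {} \<or> verts X \<inter> verts D \<noteq> {}" if "X \<in> Os" for X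
    using att[OF that] by (auto simp: attached_def Int_Un_distrib)
  \<comment> \<open>Two outer clusters cannot both miss the same child \<open>W\<close>: the other
    child \<open>U\<close> would have as boundary vertices \<open>m\<close> and the two contact
    vertices, and these three differ since \<open>m\<close> lies in \<open>W\<close> and the outer
    clusters are disjoint.\<close>
  have crowded: False
    if XY: "X \<in> Os" "Y \<in> Os" "X \<noteq> Y" and U: "U \<in> {A, D}" "W \<in> {A, D}" "U \<noteq> W"
      and off: "verts X \<inter> verts W = {}" "verts Y \<inter> verts W = {}" for X Y U W
  proof -
    obtain p q where p: "p \<in> verts X" "p \<in> verts U" and q: "q \<in> verts Y" "q \<in> verts U"
    proof -
      have "verts X \<inter> verts U \<noteq> {}" "verts Y \<inter> verts U \<noteq> {}"
        using meets[OF XY(1)] meets[OF XY(2)] U off by (elim insertE emptyE; simp)+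
      then show thesis using that by blast
    qed
    have mUW: "m \<in> verts U" "m \<in> verts W" using m U by auto
    have bdI: "r \<in> bd E B (edges U)" if r: "r \<in> verts U" "r \<in> verts Z" "Z \<in> ?S'" "Z \<noteq> U" for r Z
    proof -
      have "edges Z \<subseteq> E - edges U"
        using forest_disjoint[OF S'(1), of Z U] r U S'(1) by (auto simp: forest_def)
      then show ?thesis using r unfolding bd_def by blast
    qed
    have "{m, p, q} \<subseteq> bd E B (edges U)"
      using bdI[of m W] bdI[of p X] bdI[of q Y] p q mUW XY S U nOs by auto
    moreover have "finite (bd E B (edges U))"
      using v U finite_verts_E forest_subtree[OF S'(1), of U]
      by (auto simp: bd_def is_subtree_def intro!: finite_subset[OF _ finite_verts_E])
    moreover have "card {m, p, q} = 3"
      using p q mUW off dis[OF XY] by (auto simp: card_insert_if)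
    moreover have "card (bd E B (edges U)) \<le> 2"
      using valid_tt_cluster[of U] v U by (auto simp: is_cluster_def)
    ultimately show False using card_mono[of "bd E B (edges U)" "{m, p, q}"] by linarith
  qed
  have "\<exists>OA OD. halves ?S' A D OA OD"
  proof -
    obtain X Y where "Os \<subseteq> {X, Y}" using two by blast
    then consider "Os = {}" | Z where "Os = {Z}" | "Os = {X, Y}" "X \<noteq> Y" by blast
    then show ?thesis
    proof cases
      case 1
      then show ?thesis using glue[of "{}" "{}"] by auto
    next
      case (2 Z)
      then show ?thesis using glue[of "{Z}" "{}"] glue[of "{}" "{Z}"] meets[of Z] by auto
    next
      case 3
      \<comment> \<open>This is Hall's condition for two outer clusters and two children: each
        cluster touches a child, and by \<open>crowded\<close> no child is missed by both.\<close>
      have "verts X \<inter> verts A \<noteq> {} \<and> verts Y \<inter> verts D \<noteq> {} \<or> verts Y \<inter> verts A \<noteq> {} \<and> verts X \<inter> verts D \<noteq> {}"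
        using crowded[of X Y A D] crowded[of X Y D A] meets[of X] meets[of Y] 3 AD(1) by blast
      then show ?thesis using glue[of "{X}" "{Y}"] glue[of "{Y}" "{X}"] 3 by auto
    qed
  qed
  then show ?thesis using S'(2) by blast
qed

end

section \<open>Search programs\<close>

text \<open>A strategy is a function of the whole transcript, which is awkward to build by
  recursion. A program instead branches on the answer to each operation; \<open>next_op\<close>
  turns it into a strategy by replaying the answers recorded in the transcript.\<close>

datatype 'v prog = Halt | Step "'v op" "'v tt option \<Rightarrow> 'v prog"

fun next_op :: "'v prog \<Rightarrow> 'v event list \<Rightarrow> 'v op" where
  "next_op Halt h = Stop"
| "next_op (Step p k) [] = p"
| "next_op (Step p k) (ev # h) = next_op (k (snd ev)) h"

definition answer :: "('v tt \<Rightarrow> 'v tt) \<Rightarrow> 'v op \<Rightarrow> 'v tt option" where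
  "answer sel p = (case p of Select c \<Rightarrow> Some (sel c) | _ \<Rightarrow> None)"

primrec trace :: "('v tt \<Rightarrow> 'v tt) \<Rightarrow> 'v prog \<Rightarrow> 'v event list" where
  "trace sel Halt = []"
| "trace sel (Step p k) = (p, answer sel p) # trace sel (k (answer sel p))"

lemma next_op_trace [simp]: "next_op pr (trace sel pr) = Stop"
  by (induction pr) auto

lemma next_op_take_trace:
  "n < length (trace sel pr) \<Longrightarrow>
     (next_op pr (take n (trace sel pr)), answer sel (next_op pr (take n (trace sel pr)))) = trace sel pr ! n"
proof (induction pr arbitrary: n)
  case (Step p k)
  then show ?case by (cases n) auto
qed simp

text \<open>After every proper prefix of its own trace the program replays to the operation that the
  trace lists next, so the run reproduces the trace.\<close>

lemma run_next_op: "n \<le> length (trace sel pr) \<Longrightarrow> run sel (next_op pr) n = take n (trace sel pr)"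
proof (induction n)
  case (Suc n)
  then show ?case using next_op_take_trace[of n sel pr]
    by (simp add: Let_def take_Suc_conv_app_nth answer_def)
qed simp

definition perform :: "'v op list \<Rightarrow> 'v prog \<Rightarrow> 'v prog" where
  "perform ps pr = foldr (\<lambda>p k. Step p (\<lambda>_. k)) ps pr"

lemma is_join_or_splitD: "is_join_or_split p \<Longrightarrow> p \<noteq> Stop \<and> \<not> is_return p"
  by (cases p) auto

lemma trace_perform:
  assumes "\<forall>p\<in>set ps. is_join_or_split p"
  shows "map fst (trace sel (perform ps pr)) = ps @ map fst (trace sel pr)"
    "selects (trace sel (perform ps pr)) = selects (trace sel pr)"
proof -
  have "answer sel p = None" "sel_of (p, None) = []" if "is_join_or_split p" for p :: "'a op"
    using that by (cases p; simp add: answer_def)+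
  then show "map fst (trace sel (perform ps pr)) = ps @ map fst (trace sel pr)"
    "selects (trace sel (perform ps pr)) = selects (trace sel pr)"
    using assms by (induction ps) (auto simp: perform_def selects_def)
qed

text \<open>\<open>P\<close> is the set of candidate edges: all of \<open>E\<close> if there is at most one external boundary
  vertex, and otherwise the path between the two external boundary vertices.\<close>

inductive searches :: "'v set set \<Rightarrow> 'v set set \<Rightarrow> 'v tt \<Rightarrow> 'v tt list \<Rightarrow> ('v tt \<times> 'v tt) list \<Rightarrow> 'v set \<Rightarrow> bool"
  for E P where
  leaf: "searches E P (Leaf e) [Leaf e] [] e"
| choose: "edges A \<inter> P \<noteq> {} \<Longrightarrow> edges D \<inter> P \<noteq> {} \<Longrightarrow> edges A \<inter> edges D = {}
    \<Longrightarrow> edges A \<subseteq> edges As \<Longrightarrow> edges D \<subseteq> edges Ds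
    \<Longrightarrow> edges As \<union> edges Ds = E \<Longrightarrow> edges As \<inter> edges Ds = {}
    \<Longrightarrow> C' = A \<and> a = As \<or> C' = D \<and> a = Ds \<Longrightarrow> searches E P C' Cs ss e
    \<Longrightarrow> searches E P (Node A D) (Node A D # Cs) ((Node As Ds, a) # ss) e"
| forced: "C' = A \<and> edges D \<inter> P = {} \<or> C' = D \<and> edges A \<inter> P = {} \<Longrightarrow> edges C' \<inter> P \<noteq> {}
    \<Longrightarrow> searches E P C' Cs ss e \<Longrightarrow> searches E P (Node A D) (Node A D # Cs) ss e"

lemma searches_hd: "searches E P C Cs ss e \<Longrightarrow> Cs \<noteq> [] \<and> hd Cs = C"
  by (induction rule: searches.induct) auto

lemma descent_Cons:
  assumes "descent C' Cs e" "C' \<in> {A, D}"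
  shows "descent (Node A D) (Node A D # Cs) e"
proof -
  have Cs: "Cs \<noteq> []" "Cs ! 0 = C'" using assms(1) by (auto simp: descent_def hd_conv_nth)
  have "\<exists>A' D'. (Node A D # Cs) ! i = Node A' D' \<and> Cs ! i \<in> {A', D'}" if "i < length Cs" for i
    using that assms Cs by (cases i) (auto simp: descent_def)
  then show ?thesis using assms(1) Cs(1) by (auto simp: descent_def)
qed

lemma searches_descent: "searches E P C Cs ss e \<Longrightarrow> descent C Cs e"
proof (induction rule: searches.induct)
  case (leaf e)
  show ?case by (simp add: descent_def)
qed (auto intro: descent_Cons)

lemma searches_valid:
  assumes "searches E P C Cs ss e" "valid_tt E B C" "edges C \<inter> P \<noteq> {}"
  shows "\<forall>T\<in>set Cs. valid_tt E B T \<and> edges T \<inter> P \<noteq> {}"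
  using assms by (induction rule: searches.induct) auto

lemma searches_result:
  assumes "searches E P C Cs ss e" "edges C \<inter> P \<noteq> {}"
  shows "e \<in> edges C \<inter> P" "\<forall>ca\<in>set ss. e \<in> edges (snd ca)"
  using assms by (induction rule: searches.induct) auto

text \<open>The two sides offered to select are disjoint, so an edge in the selected side cannot lie
  in the rejected child; in a forced step the rejected child holds no candidate. Hence
  \<open>e'\<close> follows the descent to the leaf.\<close>

lemma searches_unique:
  assumes "searches E P C Cs ss e" "e' \<in> edges C \<inter> P" "\<forall>ca\<in>set ss. e' \<in> edges (snd ca)"
  shows "e' = e"
  using assms by (induction rule: searches.induct) auto

text \<open>Phrased through candidate edges so that both cases of the theorem can use it: for
  \<open>P = E\<close> it holds at every inner node of a descent in a valid top tree, and for the
  path between two external vertices it becomes \<open>both_path_children\<close>.\<close>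

definition branching :: "'v set set \<Rightarrow> 'v tt \<Rightarrow> bool" where
  "branching P C \<longleftrightarrow> (\<exists>A D. C = Node A D \<and> edges A \<inter> P \<noteq> {} \<and> edges D \<inter> P \<noteq> {})"

definition forced_step :: "'v set set \<Rightarrow> 'v tt \<Rightarrow> 'v tt \<Rightarrow> bool" where
  "forced_step P C C' \<longleftrightarrow> (\<exists>A D. C = Node A D \<and>
     (C' = A \<and> edges A \<inter> P \<noteq> {} \<and> edges D \<inter> P = {} \<or> C' = D \<and> edges D \<inter> P \<noteq> {} \<and> edges A \<inter> P = {}))"

text \<open>The last position carries the leaf and is left out, as in the list \<open>Is\<close> of
  \<open>search_ok\<close>.\<close>

definition choice_indices :: "'v set set \<Rightarrow> 'v tt list \<Rightarrow> nat list" where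
  "choice_indices P Cs = filter (\<lambda>i. branching P (Cs ! i)) [0..<length Cs - 1]"

lemma choice_indices_Cons:
  assumes "Cs \<noteq> []"
  shows "choice_indices P (C # Cs) = (if branching P C then [0] else []) @ map Suc (choice_indices P Cs)"
proof -
  have "[0..<length Cs] = 0 # map Suc [0..<length Cs - 1]"
    using assms by (simp add: map_Suc_upt upt_conv_Cons)
  then show ?thesis by (simp add: choice_indices_def filter_map comp_def)
qed

lemma select_step_Cons [simp]: "select_step E (C # Cs) (Suc i) ca \<longleftrightarrow> select_step E Cs i ca"
  by (simp add: select_step_def)

lemma searches_steps:
  assumes "searches E P C Cs ss e"
  shows "length ss = length (choice_indices P Cs)
    \<and> (\<forall>j < length ss. select_step E Cs (choice_indices P Cs ! j) (ss ! j))
    \<and> (\<forall>i < length Cs - 1. \<not> branching P (Cs ! i) \<longrightarrow> forced_step P (Cs ! i) (Cs ! Suc i))"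
  using assms
proof (induction rule: searches.induct)
  case (leaf e)
  then show ?case by (simp add: choice_indices_def)
next
  case (choose A D As Ds C' a Cs ss e)
  have Cs: "Cs \<noteq> []" "Cs ! 0 = C'" using searches_hd[OF choose.hyps(9)] by (auto simp: hd_conv_nth)
  have br: "branching P (Node A D)" using choose.hyps by (simp add: branching_def)
  \<comment> \<open>\<open>select_step\<close> asks for an equivalence, so rejecting
    \<open>As\<close> must also mean leaving \<open>A\<close>; this needs distinct sides and
    distinct children.\<close>
  have "A \<noteq> D" "As \<noteq> Ds" using choose.hyps(3,7) by auto
  then have "select_step E (Node A D # Cs) 0 (Node As Ds, a)"
    using choose.hyps Cs unfolding select_step_def by auto
  then have "select_step E (Node A D # Cs) (choice_indices P (Node A D # Cs) ! j) (((Node As Ds, a) # ss) ! j)"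
    if "j < Suc (length ss)" for j
    using br that choose.IH Cs(1) by (cases j) (auto simp: choice_indices_Cons)
  moreover have "forced_step P ((Node A D # Cs) ! i) (Cs ! i)"
    if "i < length Cs" "\<not> branching P ((Node A D # Cs) ! i)" for i
    using that br choose.IH by (cases i) auto
  ultimately show ?case using br choose.IH Cs(1) by (simp add: choice_indices_Cons)
next
  case (forced C' A D Cs ss e)
  have Cs: "Cs \<noteq> []" "Cs ! 0 = C'" using searches_hd[OF forced.hyps(3)] by (auto simp: hd_conv_nth)
  have br: "\<not> branching P (Node A D)" using forced.hyps by (auto simp: branching_def)
  have "forced_step P ((Node A D # Cs) ! i) (Cs ! i)"
    if "i < length Cs" "\<not> branching P ((Node A D # Cs) ! i)" for i
    using that forced.hyps Cs forced.IH by (cases i) (auto simp: forced_step_def)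
  then show ?case using br forced.IH Cs(1) by (simp add: choice_indices_Cons)
qed

section \<open>Search programs with cost bounds\<close>

context top_tree_search
begin

text \<open>The program is fixed before \<open>sel\<close>, as the theorem demands. The start forest
  \<open>S\<close> is arbitrary while the restoration always ends in \<open>{R}\<close>, which lets
  programs for later levels be prefixed with further operations.\<close>

definition solves :: "'v tt set \<Rightarrow> 'v tt \<Rightarrow> (('v tt \<times> 'v tt) list \<Rightarrow> 'v set \<Rightarrow> bool) \<Rightarrow> nat \<Rightarrow> nat \<Rightarrow> 'v prog \<Rightarrow> bool" where
  "solves S R Q k n pr \<longleftrightarrow> (\<forall>sel. (\<forall>a b. sel (Node a b) \<in> {a, b}) \<longrightarrow> (\<exists>e pre post.
     map fst (trace sel pr) = pre @ [Return e] @ post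
     \<and> Stop \<notin> set pre \<and> (\<forall>p\<in>set pre. \<not> is_return p)
     \<and> valid_ops E B S pre \<and> moves (fold (\<lambda>p S. apply_op S p) pre S) post {R}
     \<and> length pre \<le> k \<and> length post \<le> n \<and> Q (selects (trace sel pr)) e))"

lemma solves_mono:
  assumes "solves S R Q k n pr" "\<And>ss e. Q ss e \<Longrightarrow> Q' ss e" "k \<le> k'" "n \<le> n'"
  shows "solves S R Q' k' n' pr"
  unfolding solves_def
proof (intro allI impI)
  fix sel :: "'v tt \<Rightarrow> 'v tt" assume "\<forall>a b. sel (Node a b) \<in> {a, b}"
  then obtain e pre post where "map fst (trace sel pr) = pre @ [Return e] @ post"
     "Stop \<notin> set pre \<and> (\<forall>p\<in>set pre. \<not> is_return p)"
     "valid_ops E B S pre" "moves (fold (\<lambda>p S. apply_op S p) pre S) post {R}"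
     "length pre \<le> k" "length post \<le> n" "Q (selects (trace sel pr)) e"
    using assms(1) unfolding solves_def by blast
  then show "\<exists>e pre post. map fst (trace sel pr) = pre @ [Return e] @ post
     \<and> Stop \<notin> set pre \<and> (\<forall>p\<in>set pre. \<not> is_return p)
     \<and> valid_ops E B S pre \<and> moves (fold (\<lambda>p S. apply_op S p) pre S) post {R}
     \<and> length pre \<le> k' \<and> length post \<le> n' \<and> Q' (selects (trace sel pr)) e"
    using assms(2-4) by (meson le_trans)
qed

lemma solves_perform:
  assumes "moves S ps S'" "solves S' R Q k n pr"
  shows "solves S R Q (length ps + k) n (perform ps pr)"
  unfolding solves_def
proof (intro allI impI)
  fix sel :: "'v tt \<Rightarrow> 'v tt" assume "\<forall>a b. sel (Node a b) \<in> {a, b}"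
  then obtain e pre post where *: "map fst (trace sel pr) = pre @ [Return e] @ post"
     "Stop \<notin> set pre" "\<forall>p\<in>set pre. \<not> is_return p"
     "valid_ops E B S' pre" "moves (fold (\<lambda>p S. apply_op S p) pre S') post {R}"
     "length pre \<le> k" "length post \<le> n" "Q (selects (trace sel pr)) e"
    using assms(2) unfolding solves_def by blast
  have ps: "valid_ops E B S ps" "fold (\<lambda>p S. apply_op S p) ps S = S'" "\<forall>p\<in>set ps. is_join_or_split p"
    using assms(1) by (auto simp: moves_def)
  have js: "p \<noteq> Stop \<and> \<not> is_return p" if "p \<in> set ps" for p
    using that ps(3) is_join_or_splitD by blast
  have "map fst (trace sel (perform ps pr)) = (ps @ pre) @ [Return e] @ post"
    using trace_perform(1)[OF ps(3)] * by simp
  moreover have "Stop \<notin> set (ps @ pre)" "\<forall>p\<in>set (ps @ pre). \<not> is_return p" using js * by auto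
  moreover have "valid_ops E B S (ps @ pre)" using ps * by (simp add: valid_ops_append)
  moreover have "moves (fold (\<lambda>p S. apply_op S p) (ps @ pre) S) post {R}" using ps * by simp
  moreover have "length (ps @ pre) \<le> length ps + k" using * by simp
  moreover have "Q (selects (trace sel (perform ps pr))) e" using trace_perform(2)[OF ps(3)] * by simp
  ultimately show "\<exists>e pre post. map fst (trace sel (perform ps pr)) = pre @ [Return e] @ post
     \<and> Stop \<notin> set pre \<and> (\<forall>p\<in>set pre. \<not> is_return p)
     \<and> valid_ops E B S pre \<and> moves (fold (\<lambda>p S. apply_op S p) pre S) post {R}
     \<and> length pre \<le> length ps + k \<and> length post \<le> n \<and> Q (selects (trace sel (perform ps pr))) e"
    using *(7) by blast
qed

lemma solves_return:
  assumes "moves S ps {R}" "Q [] e"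
  shows "solves S R Q 0 (length ps) (Step (Return e) (\<lambda>_. perform ps Halt))"
  unfolding solves_def
proof (intro allI impI)
  fix sel :: "'v tt \<Rightarrow> 'v tt"
  have ps: "\<forall>p\<in>set ps. is_join_or_split p" using assms(1) by (simp add: moves_def)
  let ?pr = "Step (Return e) (\<lambda>_. perform ps Halt)"
  have "map fst (trace sel ?pr) = [] @ [Return e] @ ps" using trace_perform(1)[OF ps] by simp
  moreover have "selects (trace sel ?pr) = []"
    using trace_perform(2)[OF ps] by (simp add: selects_def answer_def)
  ultimately show "\<exists>e pre post. map fst (trace sel ?pr) = pre @ [Return e] @ post
     \<and> Stop \<notin> set pre \<and> (\<forall>p\<in>set pre. \<not> is_return p)
     \<and> valid_ops E B S pre \<and> moves (fold (\<lambda>p S. apply_op S p) pre S) post {R}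
     \<and> length pre \<le> 0 \<and> length post \<le> length ps \<and> Q (selects (trace sel ?pr)) e"
    using assms by (intro exI[of _ e] exI[of _ "[]"] exI[of _ ps]) simp
qed

text \<open>The conditions on the two continuations already contain the answered call, so that
  \<open>Q\<close> speaks about all calls from the current point on.\<close>

lemma solves_select:
  assumes "Node a b \<in> S" "a \<noteq> b"
    and "solves S R (\<lambda>ss. Q ((Node a b, a) # ss)) k n pa" "solves S R (\<lambda>ss. Q ((Node a b, b) # ss)) k n pb"
  shows "solves S R Q (Suc k) n (Step (Select (Node a b)) (\<lambda>ans. if ans = Some a then pa else pb))"
  unfolding solves_def
proof (intro allI impI)
  fix sel :: "'v tt \<Rightarrow> 'v tt" assume sel: "\<forall>a b. sel (Node a b) \<in> {a, b}"
  let ?pr = "Step (Select (Node a b)) (\<lambda>ans. if ans = Some a then pa else pb)"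
  define p where "p = (if sel (Node a b) = a then pa else pb)"
  have "solves S R (\<lambda>ss. Q ((Node a b, sel (Node a b)) # ss)) k n p"
  proof (cases "sel (Node a b) = a")
    case True
    then show ?thesis using assms(3) by (simp add: p_def)
  next
    case False
    then have "sel (Node a b) = b" using sel by blast
    then show ?thesis using False assms(4) by (simp add: p_def)
  qed
  then obtain e pre post where *: "map fst (trace sel p) = pre @ [Return e] @ post"
     "Stop \<notin> set pre" "\<forall>p\<in>set pre. \<not> is_return p"
     "valid_ops E B S pre" "moves (fold (\<lambda>p S. apply_op S p) pre S) post {R}"
     "length pre \<le> k" "length post \<le> n" "Q ((Node a b, sel (Node a b)) # selects (trace sel p)) e"
    using sel unfolding solves_def by blast
  have tr: "trace sel ?pr = (Select (Node a b), Some (sel (Node a b))) # trace sel p"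
    by (simp add: p_def answer_def)
  show "\<exists>e pre post. map fst (trace sel ?pr) = pre @ [Return e] @ post
     \<and> Stop \<notin> set pre \<and> (\<forall>p\<in>set pre. \<not> is_return p)
     \<and> valid_ops E B S pre \<and> moves (fold (\<lambda>p S. apply_op S p) pre S) post {R}
     \<and> length pre \<le> Suc k \<and> length post \<le> n \<and> Q (selects (trace sel ?pr)) e"
    unfolding tr using * assms(1)
    by (intro exI[of _ e] exI[of _ "Select (Node a b) # pre"] exI[of _ post]) (simp add: selects_def)
qed

text \<open>\<open>undo\<close> is the way back from \<open>S\<close> to \<open>{R}\<close>, carried
  along so that it can be run at the leaf. A level costs at most 10 operations: 1 split, 3 moves to
  a single root, 1 call of \<open>select\<close>, 3 moves back, and 2 to make the chosen child the
  current cluster. Only the split and the last 2 lengthen \<open>undo\<close>, hence the 3 per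
  level.\<close>

lemma search_program:
  assumes "state S C Os" "edges C \<inter> P \<noteq> {}" "moves S undo {R}"
  shows "\<exists>pr. solves S R (\<lambda>ss e. \<exists>Cs. searches E P C Cs ss e)
    (10 * height C) (length undo + 3 * height C) pr"
  using assms
proof (induction C arbitrary: S Os undo)
  case (Leaf e)
  have "\<exists>Cs. searches E P (Leaf e) Cs [] e" using searches.leaf by blast
  then show ?case using solves_return[OF Leaf.prems(3), of "\<lambda>ss e'. \<exists>Cs. searches E P (Leaf e) Cs ss e'" e] by auto
next
  case (Node A D)
  have v: "valid_tt E B (Node A D)" using Node.prems(1) by (auto simp: state_def forest_def)
  then have AD: "edges A \<inter> edges D = {}" by simp
  obtain S1 OA OD where S1: "within 1 S S1" "halves S1 A D OA OD"
    using state_split[OF Node.prems(1)] by blast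
  let ?k = "2 + 10 * max (height A) (height D)" and ?n = "length undo + 3 + 3 * max (height A) (height D)"
  let ?Q = "\<lambda>ss e. \<exists>Cs. searches E P (Node A D) Cs ss e"
  have child: "\<exists>pr. solves S1 R (\<lambda>ss e. \<exists>Cs. searches E P C' Cs ss e) ?k ?n pr"
    if C': "C' \<in> {A, D}" "edges C' \<inter> P \<noteq> {}" for C'
  proof -
    have "\<exists>S' Os. within 2 S1 S' \<and> state S' C' Os"
      using C' descend[OF S1(2)] descend[OF halves_sym[OF S1(2)]] by blast
    then obtain S' Os where S': "within 2 S1 S'" "state S' C' Os" by blast
    obtain ps where ps: "moves S1 ps S'" "length ps \<le> 2" using S'(1) by (auto simp: within_def)
    \<comment> \<open>The way back omits the excursion to the single root, which is undone before
      the descent.\<close>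
    obtain us where us: "moves S' us S" "length us \<le> 3"
      using within_sym[OF within_trans[OF S1(1) S'(1)]] by (auto simp: within_def)
    have "moves S' (us @ undo) {R}" using us(1) Node.prems(3) by (rule moves_append)
    then obtain pr where pr: "solves S' R (\<lambda>ss e. \<exists>Cs. searches E P C' Cs ss e)
        (10 * height C') (length (us @ undo) + 3 * height C') pr"
      using Node.IH C' S'(2) by blast
    have "height C' \<le> max (height A) (height D)" using C'(1) by auto
    then have "solves S1 R (\<lambda>ss e. \<exists>Cs. searches E P C' Cs ss e) ?k ?n (perform ps pr)"
      using ps us by (intro solves_mono[OF solves_perform[OF ps(1) pr]]) auto
    then show ?thesis by blast
  qed
  have "\<exists>pr. solves S1 R ?Q (9 + 10 * max (height A) (height D)) ?n pr"
  proof (cases "edges A \<inter> P \<noteq> {} \<and> edges D \<inter> P \<noteq> {}")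
    case True
    obtain As Ds where J: "within 3 S1 {Node As Ds}" "edges A \<subseteq> edges As" "edges D \<subseteq> edges Ds"
      "edges As \<union> edges Ds = E" "edges As \<inter> edges Ds = {}"
      using join_to_root[OF S1(2)] True by blast
    have neq: "As \<noteq> Ds" using J(5) by auto
    obtain ps qs where ps: "moves S1 ps {Node As Ds}" "length ps \<le> 3"
      and qs: "moves {Node As Ds} qs S1" "length qs \<le> 3" using J(1) by (auto simp: within_def)
    obtain pa where pa: "solves S1 R (\<lambda>ss e. \<exists>Cs. searches E P A Cs ss e) ?k ?n pa"
      using child[of A] True by blast
    obtain pd where pd: "solves S1 R (\<lambda>ss e. \<exists>Cs. searches E P D Cs ss e) ?k ?n pd"
      using child[of D] True by blast
    have a: "solves {Node As Ds} R (\<lambda>ss. ?Q ((Node As Ds, As) # ss)) (length qs + ?k) ?n (perform qs pa)"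
      using searches.choose[OF conjunct1[OF True] conjunct2[OF True] AD J(2-5), of A As]
      by (intro solves_mono[OF solves_perform[OF qs(1) pa]]) blast+
    have d: "solves {Node As Ds} R (\<lambda>ss. ?Q ((Node As Ds, Ds) # ss)) (length qs + ?k) ?n (perform qs pd)"
      using searches.choose[OF conjunct1[OF True] conjunct2[OF True] AD J(2-5), of D Ds]
      by (intro solves_mono[OF solves_perform[OF qs(1) pd]]) blast+
    have "Node As Ds \<in> {Node As Ds}" by simp
    note sel = solves_perform[OF ps(1) solves_select[where Q = ?Q, OF this neq a d]]
    show ?thesis by (rule exI, rule solves_mono[OF sel]) (use ps(2) qs(2) in auto)
  next
    case False
    have "edges A \<inter> P \<noteq> {} \<or> edges D \<inter> P \<noteq> {}" using Node.prems(2) by auto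
    then obtain C' where C': "C' \<in> {A, D}" "edges C' \<inter> P \<noteq> {}"
      and "C' = A \<and> edges D \<inter> P = {} \<or> C' = D \<and> edges A \<inter> P = {}"
      using False by blast
    note forced = searches.forced[OF this(3,2)]
    obtain pr where pr: "solves S1 R (\<lambda>ss e. \<exists>Cs. searches E P C' Cs ss e) ?k ?n pr"
      using child[OF C'] by blast
    show ?thesis by (rule exI, rule solves_mono[OF pr]) ((use forced in blast)[1], simp_all)
  qed
  then obtain pr where pr: "solves S1 R ?Q (9 + 10 * max (height A) (height D)) ?n pr" by blast
  obtain ps where ps: "moves S ps S1" "length ps \<le> 1" using S1(1) by (auto simp: within_def)
  show ?case by (rule exI, rule solves_mono[OF solves_perform[OF ps(1) pr]]) (use ps(2) in auto)
qed

lemma search_from_root: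
  assumes R: "top_tree E B R" and P: "E \<inter> P \<noteq> {}"
  shows "\<exists>pr. solves {R} R (\<lambda>ss e. \<exists>Cs. searches E P R Cs ss e) (10 * height R) (3 * height R) pr"
proof -
  have "state {R} R {}" "edges R \<inter> P \<noteq> {}"
    using R P by (auto simp: state_def forest_def top_tree_def)
  moreover have "moves {R} [] {R}" by (simp add: moves_def)
  ultimately show ?thesis using search_program by fastforce
qed

end

section \<open>From search programs to strategies\<close>

definition correct_search :: "'v set set \<Rightarrow> 'v set \<Rightarrow> 'v tt list \<Rightarrow> ('v tt \<times> 'v tt) list \<Rightarrow> 'v set \<Rightarrow> bool" where
  "correct_search E B Cs ss e \<longleftrightarrow>
    (if card B \<le> 1 then
       length ss = length Cs - 1
     \<and> (\<forall>i < length ss. select_step E Cs i (ss ! i))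
     \<and> e \<in> E
     \<and> (\<forall>ca\<in>set ss. e \<in> edges (snd ca))
     \<and> (\<forall>e'\<in>E. (\<forall>ca\<in>set ss. e' \<in> edges (snd ca)) \<longrightarrow> e' = e)
     else
       (let Is = filter (\<lambda>i. both_path_children E B (Cs ! i)) [0..<length Cs - 1] in
         length ss = length Is
       \<and> (\<forall>j < length Is. select_step E Cs (Is ! j) (ss ! j))
       \<and> (\<forall>i < length Cs - 1. i \<notin> set Is \<longrightarrow> unique_path_child_step E B (Cs ! i) (Cs ! Suc i))
       \<and> (\<forall>x y. B = {x, y} \<longrightarrow>
             e \<in> path_edges E x y
           \<and> (\<forall>ca\<in>set ss. e \<in> edges (snd ca))
           \<and> (\<forall>e'\<in>path_edges E x y. (\<forall>ca\<in>set ss. e' \<in> edges (snd ca)) \<longrightarrow> e' = e))))"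

lemma (in top_tree_search) search_strategy:
  assumes R: "top_tree E B R" and P: "E \<inter> P \<noteq> {}"
    and correct: "\<And>Cs ss e. searches E P R Cs ss e \<Longrightarrow> correct_search E B Cs ss e"
  shows "\<exists>st. \<forall>sel. (\<forall>a b. sel (Node a b) \<in> {a, b}) \<longrightarrow> search_ok 10 E B R sel st"
proof -
  obtain pr where pr: "solves {R} R (\<lambda>ss e. \<exists>Cs. searches E P R Cs ss e) (10 * height R) (3 * height R) pr"
    using search_from_root[OF R P] by blast
  show ?thesis
  proof (intro exI[of _ "next_op pr"] allI impI)
    fix sel :: "'v tt \<Rightarrow> 'v tt" assume "\<forall>a b. sel (Node a b) \<in> {a, b}"
    then obtain e pre post where *: "map fst (trace sel pr) = pre @ [Return e] @ post"
       "Stop \<notin> set pre" "\<forall>p\<in>set pre. \<not> is_return p"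
       "valid_ops E B {R} pre" "moves (fold (\<lambda>p S. apply_op S p) pre {R}) post {R}"
       "length pre \<le> 10 * height R" "length post \<le> 3 * height R"
       "\<exists>Cs. searches E P R Cs (selects (trace sel pr)) e"
      using pr unfolding solves_def by blast
    from *(8) obtain Cs where Cs: "searches E P R Cs (selects (trace sel pr)) e" by blast
    have post: "valid_ops E B (fold (\<lambda>p S. apply_op S p) pre {R}) post"
      "fold (\<lambda>p S. apply_op S p) post (fold (\<lambda>p S. apply_op S p) pre {R}) = {R}"
      "\<forall>p\<in>set post. is_join_or_split p"
      using *(5) by (auto simp: moves_def)
    \<comment> \<open>Running for exactly the length of the trace exhausts the program, after which
      the strategy issues \<open>Stop\<close>.\<close>
    have tr: "run sel (next_op pr) (length (trace sel pr)) = trace sel pr"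
      using run_next_op[of "length (trace sel pr)" sel pr] by simp
    have "Stop \<notin> set post" using post(3) is_join_or_splitD by blast
    then show "search_ok 10 E B R sel (next_op pr)"
      unfolding search_ok_def correct_search_def[symmetric] Let_def[of "run _ _ _"] Let_def[of "map _ _"] Let_def[of "selects _"]
      using *(1-4,6,7) post searches_descent[OF Cs] correct[OF Cs]
      by - (rule exI[of _ "length (trace sel pr)"], rule exI[of _ e], rule exI[of _ pre], rule exI[of _ post],
          rule exI[of _ Cs], simp add: tr valid_ops_append del: set_map)
  qed
qed

lemma valid_tt_subset: "valid_tt E B T \<Longrightarrow> edges T \<subseteq> E"
  by (induction T) auto

text \<open>When all edges are candidates, every inner node of the descent branches because both
  children have edges; so there is one call per step.\<close>

lemma searches_all_edges:
  assumes "searches E E R Cs ss e" "valid_tt E B R"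
  shows "length ss = length Cs - 1" "\<forall>i < length ss. select_step E Cs i (ss ! i)"
proof -
  have R: "edges R \<inter> E \<noteq> {}" using valid_tt_subset[OF assms(2)] by (simp add: Int_absorb2)
  have br: "branching E (Cs ! i)" if "i < length Cs - 1" for i
  proof -
    have i: "Suc i < length Cs" using that by simp
    then obtain A D where AD: "Cs ! i = Node A D"
      using searches_descent[OF assms(1)] unfolding descent_def by blast
    have "valid_tt E B (Node A D)"
      using searches_valid[OF assms R] AD i by (metis Suc_lessD nth_mem)
    then have "edges A \<subseteq> E" "edges D \<subseteq> E" using valid_tt_subset[of E B] by auto
    then show ?thesis using AD by (simp add: branching_def Int_absorb2)
  qed
  then have ci: "choice_indices E Cs = [0..<length Cs - 1]" by (simp add: choice_indices_def)
  show "length ss = length Cs - 1" "\<forall>i < length ss. select_step E Cs i (ss ! i)"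
    using searches_steps[OF assms(1)] ci by auto
qed

section \<open>Candidate edges and path children\<close>

lemma path_edges_tree:
  assumes E: "is_tree E" and xy: "x \<in> \<Union>E" "y \<in> \<Union>E"
  shows "path_edges E x y = {e \<in> E. \<not> conn (E - {e}) x y}"
proof -
  have "conn E x y" using E xy by (auto simp: is_tree_def conn_on_iff)
  then show ?thesis by (rule path_edges_acyclic[OF tree_acyclic[OF E]])
qed

lemma path_edges_commute:
  assumes "is_tree E" "x \<in> \<Union>E" "y \<in> \<Union>E"
  shows "path_edges E x y = path_edges E y x"
proof -
  have "conn (E - {e}) x y \<longleftrightarrow> conn (E - {e}) y x" for e
    using conn_sym[of "E - {e}" x y] conn_sym[of "E - {e}" y x] by blast
  then show ?thesis using path_edges_tree[OF assms] path_edges_tree[OF assms(1,3,2)] by simp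
qed

lemma path_edges_nonempty:
  assumes E: "is_tree E" and xy: "x \<in> \<Union>E" "y \<in> \<Union>E" "x \<noteq> y"
  shows "E \<inter> path_edges E x y \<noteq> {}"
proof -
  have "conn E x y" using E xy by (auto simp: is_tree_def conn_on_iff)
  from conn_imp_path[OF this] obtain Q where Q: "is_path E Q" "hd Q = x" "last Q = y" by blast
  \<comment> \<open>As \<open>x\<close> and \<open>y\<close> differ, the path has at least two
    vertices; its first edge is the witness.\<close>
  then obtain u v Q' where uv: "Q = u # v # Q'"
    using xy(3) by (cases Q; cases "tl Q") (auto simp: is_path_def)
  have "{u, v} \<in> path_edges E x y"
    unfolding path_edges_def using Q uv by (intro CollectI exI[of _ Q] conjI exI[of _ 0]) auto
  then show ?thesis using path_edges_tree[OF E xy(1,2)] by blast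
qed

text \<open>A connection inside \<open>F\<close> avoids every edge outside of \<open>F\<close>, so
  none of those can separate \<open>x\<close> from \<open>y\<close>.\<close>

lemma path_separates:
  assumes E: "is_tree E" and xy: "x \<in> \<Union>E" "y \<in> \<Union>E"
    and F: "is_subtree E F" "x \<in> \<Union>F" "y \<in> \<Union>F"
  shows "path_edges E x y \<subseteq> F"
proof
  fix e assume e: "e \<in> path_edges E x y"
  show "e \<in> F"
  proof (rule ccontr)
    assume "e \<notin> F"
    then have sub: "F \<subseteq> E - {e}" using F(1) by (auto simp: is_subtree_def)
    have "conn F x y" using F unfolding is_subtree_def conn_on_iff by blast
    from conn_mono[OF this sub] have "conn (E - {e}) x y" .
    then show False using e path_edges_tree[OF E xy] by simp
  qed
qed

lemma top_tree_search_single: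
  assumes "is_tree E" "B \<subseteq> \<Union>E" "card B \<le> 1"
  shows "top_tree_search E B E"
proof
  show "finite E" "\<And>e. e \<in> E \<Longrightarrow> card e = 2" using assms by (auto simp: is_tree_def)
  then have "finite (\<Union>E)" by (intro finite_Union) (auto intro: card_ge_0_finite)
  then show B: "finite B" using assms(2) finite_subset by blast
  show "card B \<le> 2" using assms by simp
  show "card (B \<inter> \<Union>F) \<le> 1" for F :: "'a set set"
    using card_mono[OF B, of "B \<inter> \<Union>F"] assms(3) by auto
qed

lemma top_tree_search_path:
  assumes E: "is_tree E" and B: "B = {x, y}" "x \<noteq> y" "B \<subseteq> \<Union>E"
  shows "top_tree_search E B (path_edges E x y)"
proof
  show "finite E" "\<And>e. e \<in> E \<Longrightarrow> card e = 2" using E by (auto simp: is_tree_def)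
  show "finite B" "card B \<le> 2" using B by auto
  fix A F assume A: "A \<inter> path_edges E x y \<noteq> {}" and F: "is_subtree E F" "F \<inter> A = {}"
  have "\<not> (x \<in> \<Union>F \<and> y \<in> \<Union>F)" 
  proof
    assume "x \<in> \<Union>F \<and> y \<in> \<Union>F"
    then have "path_edges E x y \<subseteq> F" using path_separates[OF E _ _ F(1)] B by simp
    then show False using A F(2) by blast
  qed
  then have "B \<inter> \<Union>F \<subseteq> {x} \<or> B \<inter> \<Union>F \<subseteq> {y}" using B(1) by blast
  then show "card (B \<inter> \<Union>F) \<le> 1"
    using card_mono[of "{x}" "B \<inter> \<Union>F"] card_mono[of "{y}" "B \<inter> \<Union>F"] by auto
qed

text \<open>By \<open>cluster_path_tree\<close>, such a cluster has two boundary vertices and its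
  cluster path is the part of the global path inside it; for a subset of \<open>C\<close>, meeting
  the one is meeting the other.\<close>

lemma path_child_iff:
  assumes "is_tree E" "B = {x, y}" "B \<subseteq> \<Union>E" "is_cluster E B C" "C \<inter> path_edges E x y \<noteq> {}" "A \<subseteq> C"
  shows "path_child E B C A \<longleftrightarrow> A \<inter> path_edges E x y \<noteq> {}"
  using cluster_path_tree[OF assms(1-5)] assms(6) by (auto simp: path_child_def)

lemma searches_path:
  assumes E: "is_tree E" and B: "B = {x, y}" "x \<noteq> y" "B \<subseteq> \<Union>E"
    and s: "searches E (path_edges E x y) R Cs ss e"
    and R: "valid_tt E B R" "edges R \<inter> path_edges E x y \<noteq> {}"
  shows "let Is = filter (\<lambda>i. both_path_children E B (Cs ! i)) [0..<length Cs - 1] in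
      length ss = length Is
    \<and> (\<forall>j < length Is. select_step E Cs (Is ! j) (ss ! j))
    \<and> (\<forall>i < length Cs - 1. i \<notin> set Is \<longrightarrow> unique_path_child_step E B (Cs ! i) (Cs ! Suc i))"
proof -
  let ?P = "path_edges E x y"
  interpret top_tree_search E B ?P using E B by (rule top_tree_search_path)
  \<comment> \<open>Every cluster of the descent is valid and shares an edge with the path, so path
    children are recognized by candidate edges alone.\<close>
  have child: "path_child E B (edges (Cs ! i)) (edges A) \<longleftrightarrow> edges A \<inter> ?P \<noteq> {}"
    if "i < length Cs" "edges A \<subseteq> edges (Cs ! i)" for i A
  proof (rule path_child_iff[OF E B(1,3) _ _ that(2)])
    have "valid_tt E B (Cs ! i) \<and> edges (Cs ! i) \<inter> ?P \<noteq> {}"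
      using searches_valid[OF s R] nth_mem[OF that(1)] by simp
    then show "is_cluster E B (edges (Cs ! i))" "edges (Cs ! i) \<inter> ?P \<noteq> {}"
      using valid_tt_cluster by simp_all
  qed
  have children: "path_child E B (edges (Node A D)) (edges A) \<longleftrightarrow> edges A \<inter> ?P \<noteq> {}"
    "path_child E B (edges (Node A D)) (edges D) \<longleftrightarrow> edges D \<inter> ?P \<noteq> {}"
    if "i < length Cs" "Cs ! i = Node A D" for i A D
    using child[OF that(1), of A] child[OF that(1), of D] that(2) by auto
  have "both_path_children E B (Cs ! i) \<longleftrightarrow> branching ?P (Cs ! i)" if "i < length Cs" for i
    using children[OF that] by (auto simp: both_path_children_def branching_def simp del: edges.simps)
  then have Is: "filter (\<lambda>i. both_path_children E B (Cs ! i)) [0..<length Cs - 1] = choice_indices ?P Cs"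
    unfolding choice_indices_def by (intro filter_cong) auto
  have "unique_path_child_step E B (Cs ! i) (Cs ! Suc i)"
    if i: "i < length Cs" "forced_step ?P (Cs ! i) (Cs ! Suc i)" for i
  proof -
    obtain A D where AD: "Cs ! i = Node A D"
      "Cs ! Suc i = A \<and> edges A \<inter> ?P \<noteq> {} \<and> edges D \<inter> ?P = {}
        \<or> Cs ! Suc i = D \<and> edges D \<inter> ?P \<noteq> {} \<and> edges A \<inter> ?P = {}"
      using i(2) unfolding forced_step_def by blast
    then show ?thesis
      using children[OF i(1) AD(1)] unfolding unique_path_child_step_def by simp
  qed
  then show ?thesis
    unfolding Is Let_def using searches_steps[OF s] by (simp add: choice_indices_def)
qed

theorem theorem3p1:
  shows "\<exists>K::nat. \<forall>(E :: 'v set set) (B :: 'v set) (R :: 'v tt).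
     is_tree E \<and> B \<subseteq> \<Union>E \<and> card B \<le> 2 \<and> top_tree E B R \<longrightarrow>
     (\<exists>st. \<forall>sel. (\<forall>a b. sel (Node a b) \<in> {a, b}) \<longrightarrow> search_ok K E B R sel st)"
proof (intro exI[of _ 10] allI impI)
  fix E :: "'v set set" and B :: "'v set" and R :: "'v tt"
  assume asm: "is_tree E \<and> B \<subseteq> \<Union>E \<and> card B \<le> 2 \<and> top_tree E B R"
  then have E: "is_tree E" and B: "B \<subseteq> \<Union>E" "card B \<le> 2" and R: "top_tree E B R" by auto
  then have vR: "valid_tt E B R" "edges R = E" by (auto simp: top_tree_def)
  show "\<exists>st. \<forall>sel. (\<forall>a b. sel (Node a b) \<in> {a, b}) \<longrightarrow> search_ok 10 E B R sel st"
  proof (cases "card B \<le> 1")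
    case True
    interpret top_tree_search E B E using E B(1) True by (rule top_tree_search_single)
    have ne: "E \<inter> E \<noteq> {}" "edges R \<inter> E \<noteq> {}" using vR(2) edges_nonempty[of R] by auto
    show ?thesis
    proof (rule search_strategy[OF R ne(1)])
      fix Cs ss e assume s: "searches E E R Cs ss e"
      have "\<forall>e'\<in>E. (\<forall>ca\<in>set ss. e' \<in> edges (snd ca)) \<longrightarrow> e' = e"
        using searches_unique[OF s] vR(2) by simp
      then show "correct_search E B Cs ss e"
        using searches_all_edges[OF s vR(1)] searches_result[OF s ne(2)]
        unfolding correct_search_def if_P[OF True] by simp
    qed
  next
    case False
    then have "card B = 2" using B(2) by simp
    then obtain x y where xy: "B = {x, y}" "x \<noteq> y" by (auto simp: card_2_iff)
    let ?P = "path_edges E x y"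
    interpret top_tree_search E B ?P using E xy B(1) by (rule top_tree_search_path)
    have xyE: "x \<in> \<Union>E" "y \<in> \<Union>E" using xy B(1) by auto
    have ne: "E \<inter> ?P \<noteq> {}" using path_edges_nonempty[OF E xyE xy(2)] .
    then have neR: "edges R \<inter> ?P \<noteq> {}" using vR(2) by simp
    have PE: "?P \<subseteq> edges R" using path_edges_tree[OF E xyE] vR(2) by auto
    show ?thesis
    proof (rule search_strategy[OF R ne])
      fix Cs ss e assume s: "searches E ?P R Cs ss e"
      \<comment> \<open>\<open>B\<close> does not order its two vertices, and
        \<open>search_ok\<close> quantifies over both namings.\<close>
      have P: "path_edges E x' y' = ?P" if "B = {x', y'}" for x' y'
      proof -
        have "x' = x \<and> y' = y \<or> x' = y \<and> y' = x" using that xy by (auto simp: doubleton_eq_iff)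
        then show ?thesis using path_edges_commute[OF E xyE] by auto
      qed
      have unique: "\<forall>e'\<in>?P. (\<forall>ca\<in>set ss. e' \<in> edges (snd ca)) \<longrightarrow> e' = e"
        using searches_unique[OF s] PE by (simp add: subset_iff)
      have "\<forall>x' y'. B = {x', y'} \<longrightarrow> e \<in> path_edges E x' y' \<and> (\<forall>ca\<in>set ss. e \<in> edges (snd ca))
        \<and> (\<forall>e'\<in>path_edges E x' y'. (\<forall>ca\<in>set ss. e' \<in> edges (snd ca)) \<longrightarrow> e' = e)"
      proof (intro allI impI)
        fix x' y' assume B': "B = {x', y'}"
        show "e \<in> path_edges E x' y' \<and> (\<forall>ca\<in>set ss. e \<in> edges (snd ca))
          \<and> (\<forall>e'\<in>path_edges E x' y'. (\<forall>ca\<in>set ss. e' \<in> edges (snd ca)) \<longrightarrow> e' = e)"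
          unfolding P[OF B'] using searches_result[OF s neR] unique by simp
      qed
      then show "correct_search E B Cs ss e"
        unfolding correct_search_def if_not_P[OF False]
        using searches_path[OF E xy B(1) s vR(1) neR] unfolding Let_def by simp
    qed
  qed
qed

end
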